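(* Let $\mathfrak g$ be the simple Lie algebra of type $A_{r-1}$, with the ordering of the positive roots and the root vectors $F_\beta$ fixed in the context. For $1\le i<j\le r$ and $\beta=\epsilon_i-\epsilon_j=\alpha_i+\alpha_{i+1}+\dots+\alpha_{j-1}$, $$\eta_\beta=\frac1{t_1^{(i)}\,(t_1^{(i+1)}-t_1^{(i)})\cdots(t_1^{(j-1)}-t_1^{(j-2)})}.$$
   Context: $\mathbb N=\{0,1,2,\dots\}$. Let $\ell=r-1$ be the rank. For $k\in\mathbb N^\ell$ put $|k|=\sum_i k_i$ and consider variables $t^{(i)}_j$ ($1\le i\le\ell$, $1\le j\le k_i$). $G_k=\prod_i\Sigma_{k_i}$ permutes the variables with the same upper index, $\operatorname{Sym}_k x=\sum_{\pi\in G_k}\pi\cdot x$, and $dV_k=dt^{(1)}_1\wedge\dots\wedge dt^{(1)}_{k_1}\wedge\dots\wedge dt^{(\ell)}_1\wedge\dots\wedge dt^{(\ell)}_{k_\ell}$. $U_\ell$ is the free associative $\mathbb C$-algebra on $\tilde f_1,\dots,\tilde f_\ell$, and $U_\ell[k]$ is its part of multidegree $k$. For $J:\{1,\dots,|k|\}\to\{1,\dots,\ell\}$ with $\#J^{-1}(i)=k_i$ put $\tilde f_J=\tilde f_{J(|k|)}\cdots\tilde f_{J(1)}$, and identify variables $t_1,\dots,t_{|k|}$ with the $t^{(i)}_j$ by $t_u=t^{(J(u))}_{c(u)}$, where $c$ restricted to $J^{-1}(i)$ is the increasing bijection onto $\{1,\dots,k_i\}$. The canonical differential form is $\Omega_k=\sum_J\operatorname{Sym}_k\big(\prod_{u=1}^{|k|}\frac1{t_u-t_{u-1}}\big)dV_k\otimes\tilde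 f_J$ ($t_0=0$; in each summand the identification is given by $J$). $U(\mathfrak n_-)$ is generated by the Chevalley generators $f_1,\dots,f_\ell$ ($f_i$ corresponding to $\alpha_i$) subject to the Serre relations. $q:U_\ell\to U(\mathfrak n_-)$, $\tilde f_i\mapsto f_i$, is the quotient map, and $\Omega^{\mathfrak g}_k=(\mathrm{id}\otimes q)\Omega_k$. An element has content $k$ if it lies in $q(U_\ell[k])$. For a linear ordering $\beta_1<\dots<\beta_m$ of the positive roots and generators $F_\beta$ of the one-dimensional root spaces of $\mathfrak n_-$, let $F^p=F_{\beta_1}^{p_1}\cdots F_{\beta_m}^{p_m}$ ($p\in\mathbb N^m$) be the PBW basis. Define rational functions $\omega_p$ by $\Omega^{\mathfrak g}_k=\sum_p\omega_p\,dV_k\otimes F^p$, the sum being over $p$ with $F^p$ of content $k$. For a positive root $\beta$, $\eta_\beta$ denotes the coefficient $\omega_p$ for the $p$ with $F^p=F_\beta$. Type $A_{r-1}$ data: positive roots $\epsilon_i-\epsilon_j$ ($1\le i<j\le r$); simple roots $\alpha_i=\epsilon_i-\epsilon_{i+1}$ ($1\le i<r$). Ordering: $\epsilon_i-\epsilon_j<\epsilon_{i'}-\epsilon_{j'}$ if $i<i'$, or $i=i'$ and $j<j'$. Root vectors: $F_{\epsilon_i-\epsilon_j}=[f_{j-1},[f_{j-2},[\dots,[f_{i+1},f_i]\dots]]]$. *)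

theory Defs
  imports
    Complex_Main
    "HOL-Library.FuncSet"
    "HOL-Library.Poly_Mapping"
    "HOL-Library.Product_Lexorder"
    "HOL-Computational_Algebra.Fraction_Field"
    "HOL-Combinatorics.Permutations"
    "HOL-Algebra.QuotRing"
    "HOL-Algebra.Module"
begin

section \<open>Rational functions\<close>

text \<open>
  The variable with upper index \<open>i\<close> and lower index \<open>j\<close> is the pair \<open>(i, j)\<close>, a monomial is a
  finitely supported exponent vector, and \<open>ratfun\<close> is the field of rational functions over the
  complex numbers in all these variables.  The order on pairs is needed only for the instance of
  class \<open>idom\<close>.
\<close>

type_synonym mpoly = "((nat \<times> nat) \<Rightarrow>\<^sub>0 nat) \<Rightarrow>\<^sub>0 complex"
type_synonym ratfun = "mpoly fract"

definition tvar :: "nat \<Rightarrow> nat \<Rightarrow> ratfun" where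
  "tvar i j = Fract (Poly_Mapping.single (Poly_Mapping.single (i, j) 1) 1) 1"

definition rconst :: "complex \<Rightarrow> ratfun" where
  "rconst c = Fract (Poly_Mapping.single 0 c) 1"


section \<open>The free algebra\<close>

text \<open>Words form the free monoid, written additively so that the convolution product of
  \<open>Poly_Mapping\<close> on \<open>nat list \<Rightarrow>\<^sub>0 complex\<close> is the product of the free associative algebra.\<close>

instantiation list :: (type) monoid_add
begin
definition zero_list :: "'a list" where "zero_list = []"
definition plus_list :: "'a list \<Rightarrow> 'a list \<Rightarrow> 'a list" where "plus_list xs ys = xs @ ys"
instance by standard (simp_all add: zero_list_def plus_list_def)
end

type_synonym falg = "nat list \<Rightarrow>\<^sub>0 complex"

definition fgen :: "nat \<Rightarrow> falg" where
  "fgen i = Poly_Mapping.single [i] 1"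

text \<open>Throughout, \<open>r - 1\<close> is the rank, so that \<open>{1..<r}\<close> indexes the simple roots.\<close>

definition U_free :: "nat \<Rightarrow> (complex, falg) module" where
  "U_free r = \<lparr>carrier = {x. \<forall>w\<in>Poly_Mapping.keys x. set w \<subseteq> {1..<r}},
     mult = (*), one = 1, zero = 0, add = (+),
     smult = (\<lambda>c x. Poly_Mapping.single [] c * x)\<rparr>"

definition U_deg :: "nat \<Rightarrow> (nat \<Rightarrow> nat) \<Rightarrow> falg set" where
  "U_deg r k = {x \<in> carrier (U_free r).
     \<forall>w\<in>Poly_Mapping.keys x. \<forall>i\<in>{1..<r}. count_list w i = k i}"


section \<open>The enveloping algebra of the nilpotent subalgebra in type A\<close>

definition cartan :: "nat \<Rightarrow> nat \<Rightarrow> int" where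
  "cartan i j = (if i = j then 2 else if i = Suc j \<or> j = Suc i then -1 else 0)"

definition serre_rels :: "nat \<Rightarrow> falg set" where
  "serre_rels r =
     {((\<lambda>y. fgen i * y - y * fgen i) ^^ nat (1 - cartan i j)) (fgen j) | i j.
        i \<in> {1..<r} \<and> j \<in> {1..<r} \<and> i \<noteq> j}"

definition serre_ideal :: "nat \<Rightarrow> falg set" where
  "serre_ideal r = Idl\<^bsub>U_free r\<^esub> (serre_rels r)"

definition qmap :: "nat \<Rightarrow> falg \<Rightarrow> falg set" where
  "qmap r x = serre_ideal r +>\<^bsub>U_free r\<^esub> x"

definition U_nminus :: "nat \<Rightarrow> (complex, falg set) module" where
  "U_nminus r = ring.extend (U_free r Quot serre_ideal r)
     \<lparr>smult = (\<lambda>c X. \<Union>x\<in>X. qmap r (c \<odot>\<^bsub>U_free r\<^esub> x))\<rparr>"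

definition has_content :: "nat \<Rightarrow> (nat \<Rightarrow> nat) \<Rightarrow> falg set \<Rightarrow> bool" where
  "has_content r k X \<longleftrightarrow> X \<in> qmap r ` U_deg r k"


section \<open>Positive roots, root vectors and PBW monomials\<close>

text \<open>The pair \<open>(i, j)\<close> stands for the root \<open>\<epsilon>\<^sub>i - \<epsilon>\<^sub>j\<close>.  The list contains the positive roots in
  increasing order.\<close>

definition pos_roots :: "nat \<Rightarrow> (nat \<times> nat) list" where
  "pos_roots r = [(i, j). i \<leftarrow> [1..<r], j \<leftarrow> [Suc i..<Suc r]]"

text \<open>Coefficients of \<open>\<epsilon>\<^sub>i - \<epsilon>\<^sub>j\<close> in the basis of simple roots \<open>\<alpha>\<^sub>m = \<epsilon>\<^sub>m - \<epsilon>\<^bsub>m+1\<^esub>\<close>.\<close>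

fun root_coeff :: "nat \<times> nat \<Rightarrow> nat \<Rightarrow> nat" where
  "root_coeff (i, j) m = (if i \<le> m \<and> m < j then 1 else 0)"

definition eps :: "nat \<Rightarrow> nat \<Rightarrow> int" where
  "eps i = (\<lambda>n. if n = i then 1 else 0)"

lemma root_coeff_correct:
  assumes "1 \<le> i" "i < j" "j \<le> r"
  shows "eps i n - eps j n =
    (\<Sum>m\<in>{1..<r}. int (root_coeff (i, j) m) * (eps m n - eps (Suc m) n))"
proof -
  have "(\<Sum>m\<in>{1..<r}. int (root_coeff (i, j) m) * (eps m n - eps (Suc m) n))
      = (\<Sum>m\<in>{i..<j}. int (root_coeff (i, j) m) * (eps m n - eps (Suc m) n))"
    using assms by (intro sum.mono_neutral_right) auto
  also have "\<dots> = (\<Sum>m\<in>{i..<j}. - (eps (Suc m) n - eps m n))"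
    by (intro sum.cong) auto
  also have "\<dots> = eps i n - eps j n"
    using sum_Suc_diff'[of i j "\<lambda>m. eps m n"] assms by (simp only: sum_negf less_imp_le)
  finally show ?thesis by simp
qed

definition bracket :: "('a, 'm) ring_scheme \<Rightarrow> 'a \<Rightarrow> 'a \<Rightarrow> 'a" where
  "bracket A x y = (x \<otimes>\<^bsub>A\<^esub> y) \<ominus>\<^bsub>A\<^esub> (y \<otimes>\<^bsub>A\<^esub> x)"

fun root_vec :: "nat \<Rightarrow> nat \<times> nat \<Rightarrow> falg set" where
  "root_vec r (i, j) =
     foldl (\<lambda>X m. bracket (U_nminus r) (qmap r (fgen m)) X) (qmap r (fgen i)) [Suc i..<j]"

definition exponents :: "nat \<Rightarrow> (nat \<times> nat \<Rightarrow> nat) set" where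
  "exponents r = {p. \<forall>\<beta>. \<beta> \<notin> set (pos_roots r) \<longrightarrow> p \<beta> = 0}"

definition pbw :: "nat \<Rightarrow> (nat \<times> nat \<Rightarrow> nat) \<Rightarrow> falg set" where
  "pbw r p = foldr (\<lambda>\<beta> X. (root_vec r \<beta> [^]\<^bsub>U_nminus r\<^esub> p \<beta>) \<otimes>\<^bsub>U_nminus r\<^esub> X)
     (pos_roots r) \<one>\<^bsub>U_nminus r\<^esub>"


section \<open>Tensor product of the rational functions with a complex vector space\<close>

text \<open>
  An element of the tensor product over the complex numbers of \<open>ratfun\<close> with \<open>V\<close> is represented by
  a formal \<open>ratfun\<close>-linear combination of elements of \<open>V\<close>.  Two representatives denote the same
  element iff their difference lies in the subspace \<open>tensor_null V\<close> spanned by the relations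
  below; the relations carry an arbitrary factor \<open>g\<close>, so the additive closure is a
  \<open>ratfun\<close>-subspace.
\<close>

abbreviation pure_tensor :: "ratfun \<Rightarrow> 'v \<Rightarrow> 'v \<Rightarrow>\<^sub>0 ratfun" where
  "pure_tensor g v \<equiv> Poly_Mapping.single v g"

inductive_set tensor_null :: "(complex, 'v) module \<Rightarrow> ('v \<Rightarrow>\<^sub>0 ratfun) set"
  for V :: "(complex, 'v) module" where
  null_zero: "0 \<in> tensor_null V"
| null_add: "x \<in> tensor_null V \<Longrightarrow> y \<in> tensor_null V \<Longrightarrow> x + y \<in> tensor_null V"
| null_additive: "u \<in> carrier V \<Longrightarrow> v \<in> carrier V \<Longrightarrow>
    pure_tensor g (u \<oplus>\<^bsub>V\<^esub> v) - pure_tensor g u - pure_tensor g v \<in> tensor_null V"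
| null_scalar: "v \<in> carrier V \<Longrightarrow>
    pure_tensor g (c \<odot>\<^bsub>V\<^esub> v) - pure_tensor (g * rconst c) v \<in> tensor_null V"

definition tensor_eq :: "(complex, 'v) module \<Rightarrow> ('v \<Rightarrow>\<^sub>0 ratfun) \<Rightarrow> ('v \<Rightarrow>\<^sub>0 ratfun) \<Rightarrow> bool" where
  "tensor_eq V x y \<longleftrightarrow> x - y \<in> tensor_null V"

definition id_tensor :: "('v \<Rightarrow> 'w) \<Rightarrow> ('v \<Rightarrow>\<^sub>0 ratfun) \<Rightarrow> ('w \<Rightarrow>\<^sub>0 ratfun)" where
  "id_tensor \<phi> x = (\<Sum>v\<in>Poly_Mapping.keys x. pure_tensor (Poly_Mapping.lookup x v) (\<phi> v))"


section \<open>The canonical differential form\<close>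

text \<open>
  All forms that occur are multiples of the single form \<open>dV\<^sub>k\<close>, and symmetrization applies only to
  its coefficient; a form is therefore represented by its coefficient of \<open>dV\<^sub>k\<close>.
  As \<open>k\<close> is only used on \<open>{1..<r}\<close>, it is a function on \<open>nat\<close>.
\<close>

definition size_k :: "nat \<Rightarrow> (nat \<Rightarrow> nat) \<Rightarrow> nat" where
  "size_k r k = (\<Sum>i\<in>{1..<r}. k i)"

definition G_group :: "nat \<Rightarrow> (nat \<Rightarrow> nat) \<Rightarrow> (nat \<Rightarrow> nat \<Rightarrow> nat) set" where
  "G_group r k = (\<Pi>\<^sub>E i\<in>{1..<r}. {\<pi>. \<pi> permutes {1..k i}})"

text \<open>The argument \<open>R\<close> is a rational expression in the variables; \<open>\<pi>\<close> acts by substituting the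
  permuted variables into it.\<close>

definition Sym :: "nat \<Rightarrow> (nat \<Rightarrow> nat) \<Rightarrow> ((nat \<Rightarrow> nat \<Rightarrow> ratfun) \<Rightarrow> ratfun) \<Rightarrow> ratfun" where
  "Sym r k R = (\<Sum>\<pi>\<in>G_group r k. R (\<lambda>i j. tvar i (\<pi> i j)))"

definition colorings :: "nat \<Rightarrow> (nat \<Rightarrow> nat) \<Rightarrow> (nat \<Rightarrow> nat) set" where
  "colorings r k = {J \<in> {1..size_k r k} \<rightarrow>\<^sub>E {1..<r}.
     \<forall>i\<in>{1..<r}. card {u \<in> {1..size_k r k}. J u = i} = k i}"

definition cpos :: "(nat \<Rightarrow> nat) \<Rightarrow> nat \<Rightarrow> nat" where
  "cpos J u = card {v \<in> {1..u}. J v = J u}"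

lemma cpos_increasing_bijection:
  assumes J: "J \<in> colorings r k" and i: "i \<in> {1..<r}"
  defines "A \<equiv> {u \<in> {1..size_k r k}. J u = i}"
  shows "strict_mono_on A (cpos J)" and "bij_betw (cpos J) A {1..k i}"
proof -
  show mono: "strict_mono_on A (cpos J)"
  proof (rule strict_mono_onI)
    fix u v assume uv: "u \<in> A" "v \<in> A" "u < v"
    have "{w \<in> {1..u}. J w = J u} \<subset> {w \<in> {1..v}. J w = J v}"
    proof (rule psubsetI)
      show "{w \<in> {1..u}. J w = J u} \<subseteq> {w \<in> {1..v}. J w = J v}"
        using uv by (auto simp: A_def)
      have "v \<in> {w \<in> {1..v}. J w = J v}" "v \<notin> {w \<in> {1..u}. J w = J u}"
        using uv by (auto simp: A_def)
      then show "{w \<in> {1..u}. J w = J u} \<noteq> {w \<in> {1..v}. J w = J v}" by blast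
    qed
    then show "cpos J u < cpos J v"
      unfolding cpos_def by (intro psubset_card_mono) auto
  qed
  have fin: "finite A" and cardA: "card A = k i"
    using J i by (auto simp: A_def colorings_def)
  have inj: "inj_on (cpos J) A"
    using mono by (rule strict_mono_on_imp_inj_on)
  have "cpos J ` A \<subseteq> {1..k i}"
  proof
    fix n assume "n \<in> cpos J ` A"
    then obtain u where u: "u \<in> A" "n = cpos J u" by blast
    have "{v \<in> {1..u}. J v = J u} \<subseteq> A" "u \<in> {v \<in> {1..u}. J v = J u}"
      using u by (auto simp: A_def)
    then show "n \<in> {1..k i}"
      using u(2) card_mono[OF fin] cardA unfolding cpos_def
      by (metis (no_types, lifting) One_nat_def Suc_leI atLeastAtMost_iff card_gt_0_iff
          empty_iff fin finite_subset)
  qed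
  then have "cpos J ` A = {1..k i}"
    using card_image[OF inj] cardA by (intro card_subset_eq) auto
  then show "bij_betw (cpos J) A {1..k i}"
    using inj by (simp add: bij_betw_def)
qed

text \<open>The product in the summand of \<open>J\<close>, as an expression in the variables \<open>x\<close>.\<close>

definition tseq :: "(nat \<Rightarrow> nat) \<Rightarrow> (nat \<Rightarrow> nat \<Rightarrow> ratfun) \<Rightarrow> nat \<Rightarrow> ratfun" where
  "tseq J x u = (if u = 0 then 0 else x (J u) (cpos J u))"

definition chain_prod :: "nat \<Rightarrow> (nat \<Rightarrow> nat) \<Rightarrow> (nat \<Rightarrow> nat \<Rightarrow> ratfun) \<Rightarrow> ratfun" where
  "chain_prod n J x = (\<Prod>u\<in>{1..n}. 1 / (tseq J x u - tseq J x (u - 1)))"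

definition fJ :: "nat \<Rightarrow> (nat \<Rightarrow> nat) \<Rightarrow> falg" where
  "fJ n J = prod_list (map (\<lambda>u. fgen (J u)) (rev [1..<Suc n]))"

definition Omega :: "nat \<Rightarrow> (nat \<Rightarrow> nat) \<Rightarrow> falg \<Rightarrow>\<^sub>0 ratfun" where
  "Omega r k = (\<Sum>J\<in>colorings r k.
     pure_tensor (Sym r k (chain_prod (size_k r k) J)) (fJ (size_k r k) J))"

definition Omega_g :: "nat \<Rightarrow> (nat \<Rightarrow> nat) \<Rightarrow> falg set \<Rightarrow>\<^sub>0 ratfun" where
  "Omega_g r k = id_tensor (qmap r) (Omega r k)"

definition omega :: "nat \<Rightarrow> (nat \<Rightarrow> nat) \<Rightarrow> (nat \<times> nat \<Rightarrow> nat) \<Rightarrow> ratfun" where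
  "omega r k = (let P = {p \<in> exponents r. has_content r k (pbw r p)} in
     THE w. (\<forall>p. p \<notin> P \<longrightarrow> w p = 0) \<and>
       tensor_eq (U_nminus r) (Omega_g r k) (\<Sum>p\<in>P. pure_tensor (w p) (pbw r p)))"

definition eta :: "nat \<Rightarrow> nat \<times> nat \<Rightarrow> ratfun" where
  "eta r \<beta> = omega r (root_coeff \<beta>) (THE p. p \<in> exponents r \<and> pbw r p = root_vec r \<beta>)"

end

theory Submission
  imports Defs
begin

text \<open>
  Let \<open>f\<^sub>m\<close> act on monomials \<open>x\<^sup>N\<close> with arbitrary complex exponents as \<open>x\<^bsub>m+1\<^esub> \<partial>/\<partial>x\<^sub>m\<close>; the root vector of
  \<open>\<epsilon>\<^sub>a - \<epsilon>\<^sub>b\<close> then acts as \<open>x\<^sub>b \<partial>/\<partial>x\<^sub>a\<close>.  For half-integral \<open>N\<close> no PBW monomial kills \<open>x\<^sup>N\<close>, so the content of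
  a PBW monomial is well defined, and those with the content of \<open>\<epsilon>\<^sub>i - \<epsilon>\<^sub>j\<close> are the products over chains
  \<open>i = c\<^sub>0 < c\<^sub>1 < \<dots> < c\<^sub>s = j\<close>.  Such a product multiplies \<open>x\<^sup>N\<close> by \<open>N\<close> taken at \<open>c\<^sub>0, \<dots>, c\<^bsub>s-1\<^esub>\<close>; choosing \<open>N\<close>
  in \<open>{0, 1}\<close> gives linear independence, and spanning follows by moving the largest letter of a word to
  one of its ends.  For \<open>N = e\<^sub>i\<close> only the root vector itself survives among the chains, and only the word
  \<open>f\<^bsub>j-1\<^esub> \<cdots> f\<^sub>i\<close> among the words, so the coefficient of this word in the canonical form is \<open>\<eta>\<close>.
\<close>


section \<open>Operators on functions of exponent vectors\<close>

text \<open>Turns \<open>update\<close> into the addition of a \<open>single\<close>, so that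
  identities between additive functions of \<open>x\<close> reduce to one monomial.\<close>

lemma poly_mapping_add_induct [case_names zero add]:
  fixes x :: "'a \<Rightarrow>\<^sub>0 'b::comm_monoid_add"
  assumes "P 0"
    and "\<And>k c x. k \<notin> Poly_Mapping.keys x \<Longrightarrow> c \<noteq> 0 \<Longrightarrow> P x \<Longrightarrow> P (Poly_Mapping.single k c + x)"
  shows "P x"
proof (induction x rule: update_induct)
  case const
  then show ?case by (rule assms(1))
next
  case (update f a b)
  have "Poly_Mapping.update a b f = Poly_Mapping.single a b + f"
    using update(1)
    by (intro poly_mapping_eqI)
      (auto simp: lookup_update lookup_add lookup_single when_def in_keys_iff)
  then show ?case using assms(2)[OF update(1) update(2) update(3)] by simp
qed

type_synonym exvec = "nat \<Rightarrow> complex"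

text \<open>Using indicators instead of function updates makes \<open>a = b\<close> the identity and
  lets shifts compose and commute without case distinctions.\<close>

definition shift :: "nat \<Rightarrow> nat \<Rightarrow> exvec \<Rightarrow> exvec" where
  "shift a b N = (\<lambda>n. N n - of_bool (n = a) + of_bool (n = b))"

text \<open>Read \<open>g\<close> as the linear functional with value \<open>g N\<close> on
  \<open>x^N\<close>. This is its composition with \<open>x_b d/dx_a\<close>, which sends
  \<open>x^N\<close> to \<open>N a\<close> times the monomial with exponent
  \<open>shift a b N\<close>.\<close>

definition lowering :: "nat \<Rightarrow> nat \<Rightarrow> (exvec \<Rightarrow> complex) \<Rightarrow> exvec \<Rightarrow> complex" where
  "lowering a b g = (\<lambda>N. N a * g (shift a b N))"

definition word_op :: "nat list \<Rightarrow> (exvec \<Rightarrow> complex) \<Rightarrow> exvec \<Rightarrow> complex" where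
  "word_op w g = foldl (\<lambda>g m. lowering m (Suc m) g) g w"

definition act :: "falg \<Rightarrow> (exvec \<Rightarrow> complex) \<Rightarrow> exvec \<Rightarrow> complex" where
  "act x g N = (\<Sum>w\<in>Poly_Mapping.keys x. Poly_Mapping.lookup x w * word_op w g N)"

lemma shift_same [simp]: "shift a a N = N"
  by (simp add: shift_def fun_eq_iff)

lemma shift_shift: "shift a b (shift b c N) = shift a c N"
  by (simp add: shift_def fun_eq_iff)

lemma shift_commute: "shift a b (shift c d N) = shift c d (shift a b N)"
  by (simp add: shift_def fun_eq_iff)

lemma word_op_Nil [simp]: "word_op [] g = g"
  by (simp add: word_op_def)

lemma word_op_append: "word_op (u @ v) g = word_op v (word_op u g)"
  by (simp add: word_op_def)

lemma word_op_Cons: "word_op (m # w) g = word_op w (lowering m (Suc m) g)"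
  by (simp add: word_op_def)

lemma word_op_linear: "word_op w (\<lambda>M. c * g M + h M) N = c * word_op w g N + word_op w h N"
proof (induction w arbitrary: N rule: rev_induct)
  case (snoc m w)
  then show ?case
    by (simp add: word_op_append word_op_Cons lowering_def distrib_left mult.left_commute)
qed simp

lemma word_op_scale: "word_op w (\<lambda>M. c * g M) N = c * word_op w g N"
  \<comment> \<open>The second instance says \<open>z = z + z\<close> for the value \<open>z\<close>
    at the zero function, hence \<open>z = 0\<close>.\<close>
  using word_op_linear[of w c g "\<lambda>M. 0" N] word_op_linear[of w 1 "\<lambda>M. 0" "\<lambda>M. 0" N] by simp

text \<open>Terms may cancel in a sum of algebra elements, so additivity is proved over a common
  index set larger than the supports.\<close>

lemma act_superset:
  "finite A \<Longrightarrow> Poly_Mapping.keys x \<subseteq> A \<Longrightarrow>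
    act x g N = (\<Sum>w\<in>A. Poly_Mapping.lookup x w * word_op w g N)"
  unfolding act_def by (intro sum.mono_neutral_left) (auto simp: in_keys_iff)

lemma act_zero [simp]: "act 0 g = (\<lambda>N. 0)"
  by (simp add: act_def fun_eq_iff)

lemma act_add: "act (x + y) g N = act x g N + act y g N"
  by (simp add: act_superset[of "Poly_Mapping.keys x \<union> Poly_Mapping.keys y"]
      keys_add lookup_add distrib_right sum.distrib)

lemma act_diff: "act (x - y) g N = act x g N - act y g N"
  using act_add[of "x - y" y g N] by simp

lemma act_single: "act (Poly_Mapping.single w c) g N = c * word_op w g N"
  by (simp add: act_superset[of "{w}"])

lemma act_one [simp]: "act 1 g = g"
  by (simp add: fun_eq_iff act_single zero_list_def flip: single_one)

lemma act_fgen: "act (fgen m) g = lowering m (Suc m) g"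
  by (simp add: fun_eq_iff fgen_def act_single word_op_Cons)

lemma act_linear: "act x (\<lambda>M. c * g M + h M) N = c * act x g N + act x h N"
  by (simp add: act_def word_op_linear sum.distrib sum_distrib_left distrib_left mult.left_commute)

lemma act_fun_scale: "act x (\<lambda>M. c * g M) N = c * act x g N"
  and act_fun_add: "act x (\<lambda>M. g M + h M) N = act x g N + act x h N"
  and act_fun_zero: "act x (\<lambda>M. 0) N = 0"
proof -
  show *: "act x (\<lambda>M. 0) N = 0" for N
    using act_linear[of x 1 "\<lambda>M. 0" "\<lambda>M. 0" N] by simp
  show "act x (\<lambda>M. c * g M) N = c * act x g N"
    using act_linear[of x c g "\<lambda>M. 0" N] by (simp add: *)
  show "act x (\<lambda>M. g M + h M) N = act x g N + act x h N"
    using act_linear[of x 1 g h N] by simp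
qed

text \<open>The order of the factors is reversed because the operators act on functions of the exponent
  vector, dually to the action of \<open>x\<^bsub>m+1\<^esub> \<partial>/\<partial>x\<^sub>m\<close> on monomials.\<close>

lemma act_mult: "act (x * y) g N = act y (act x g) N"
proof (induction x arbitrary: N rule: poly_mapping_add_induct)
  case zero
  then show ?case by (simp add: act_fun_zero)
next
  case (add k c x)
  have single: "act (Poly_Mapping.single k c * y) g N = act y (act (Poly_Mapping.single k c) g) N"
  proof (induction y rule: poly_mapping_add_induct)
    case (add l d y)
    then show ?case
      by (simp add: distrib_left act_add mult_single act_single plus_list_def word_op_append)
        (simp add: act_single[abs_def] word_op_scale)
  qed simp
  show ?case
    using add single by (simp add: distrib_right act_add act_fun_add act_add[abs_def])
qed

lemma shift_apply: "shift a b N n = N n - of_bool (n = a) + of_bool (n = b)"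
  by (simp add: shift_def)

lemma act_commutator:
  "act (x * y - y * x) g N = act y (act x g) N - act x (act y g) N"
  by (simp add: act_diff act_mult)

text \<open>All words of one relation perform the same shifts in different orders. After sorting by
  \<open>shift_commute\<close>, a polynomial identity in the values of \<open>N\<close>
  remains.\<close>

lemma act_serre_rels:
  assumes "s \<in> serre_rels r"
  shows "act s g N = 0"
proof -
  obtain i j where s: "s = ((\<lambda>y. fgen i * y - y * fgen i) ^^ nat (1 - cartan i j)) (fgen j)" and "i \<noteq> j"
    using assms by (auto simp: serre_rels_def)
  then consider "i = Suc j" | "j = Suc i" | "i \<noteq> Suc j" "j \<noteq> Suc i" by blast
  then show ?thesis
  proof cases
    case 1
    \<comment> \<open>For adjacent indices the exponent \<open>1 - cartan i j\<close> is 2, so the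
      relation is a double commutator.\<close>
    have "act s = act (fgen i * (fgen i * fgen j - fgen j * fgen i)
        - (fgen i * fgen j - fgen j * fgen i) * fgen i)"
      using 1 by (simp add: s cartan_def numeral_2_eq_2)
    then show ?thesis
      using 1
      by (simp only: act_diff act_mult act_fgen lowering_def shift_apply shift_commute)
        (simp add: algebra_simps)
  next
    case 2
    have "act s = act (fgen i * (fgen i * fgen j - fgen j * fgen i)
        - (fgen i * fgen j - fgen j * fgen i) * fgen i)"
      using 2 by (simp add: s cartan_def numeral_2_eq_2)
    then show ?thesis
      using 2
      by (simp only: act_diff act_mult act_fgen lowering_def shift_apply shift_commute)
        (simp add: algebra_simps)
  next
    case 3
    have "act s = act (fgen i * fgen j - fgen j * fgen i)"
      using 3 \<open>i \<noteq> j\<close> by (simp add: s cartan_def)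
    then show ?thesis
      using 3 \<open>i \<noteq> j\<close> by (simp add: act_diff act_mult act_fgen lowering_def shift_apply shift_commute)
  qed
qed


section \<open>Products of root vectors in the free algebra\<close>

text \<open>Lifts \<open>root_vec\<close> to the free algebra, where products and the action can be
  computed without cosets.\<close>

fun free_root :: "nat \<times> nat \<Rightarrow> falg" where
  "free_root (i, j) = foldl (\<lambda>X m. fgen m * X - X * fgen m) (fgen i) [Suc i..<j]"

declare free_root.simps [simp del]

abbreviation free_prod :: "(nat \<times> nat) list \<Rightarrow> falg" where
  "free_prod L \<equiv> prod_list (map free_root L)"

lemma free_root_simple: "free_root (i, Suc i) = fgen i"
  by (simp add: free_root.simps)

lemma free_root_Suc:
  "i < j \<Longrightarrow> free_root (i, Suc j) = fgen j * free_root (i, j) - free_root (i, j) * fgen j"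
  by (simp add: free_root.simps)

text \<open>The commutator of \<open>x_(j+1) d/dx_j\<close> with \<open>x_j d/dx_i\<close> is
  \<open>x_(j+1) d/dx_i\<close>: the two orders give the scalars \<open>N i * (N j + 1)\<close> and
  \<open>N i * N j\<close>.\<close>

lemma act_free_root: "i < j \<Longrightarrow> act (free_root (i, j)) g N = lowering i j g N"
proof (induction j arbitrary: g N)
  case (Suc j)
  show ?case
  proof (cases "i = j")
    case True
    then show ?thesis by (simp add: free_root_simple act_fgen)
  next
    case False
    then have "i < j" using Suc.prems by simp
    have op: "act (free_root (i, j)) = lowering i j"
      using Suc.IH[OF \<open>i < j\<close>] by (simp add: fun_eq_iff)
    \<comment> \<open>The intermediate index \<open>j\<close> cancels in both orders, so both
      products evaluate \<open>g\<close> at the same exponent.\<close>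
    have "shift i j (shift j (Suc j) N) = shift i (Suc j) N"
      "shift j (Suc j) (shift i j N) = shift i (Suc j) N"
      by (simp_all add: shift_shift shift_commute[of j])
    then show ?thesis
      using \<open>i < j\<close>
      by (simp add: free_root_Suc act_commutator op act_fgen lowering_def shift_apply algebra_simps)
  qed
qed simp

text \<open>\<open>foldr\<close> applies the last root first, as the product of operators does on
  monomials.\<close>

definition shifts :: "(nat \<times> nat) list \<Rightarrow> exvec \<Rightarrow> exvec" where
  "shifts L N = foldr (\<lambda>(a, b). shift a b) L N"

lemma shifts_Nil [simp]: "shifts [] N = N"
  and shifts_Cons [simp]: "shifts ((a, b) # L) N = shift a b (shifts L N)"
  by (simp_all add: shifts_def)

text \<open>One unit moves from position \<open>a\<close> to position \<open>b\<close>, and the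
  partial sum up to \<open>m\<close> loses it exactly when \<open>a \<le> m < b\<close>. Partial
  sums thus read off simple root coefficients.\<close>

lemma sum_shift:
  "a < b \<Longrightarrow> (\<Sum>n\<le>m. shift a b N n) = (\<Sum>n\<le>m. N n) - of_nat (root_coeff (a, b) m)"
  by (induction m) (auto simp: shift_apply)

lemma sum_shifts:
  "\<forall>(a, b)\<in>set L. a < b \<Longrightarrow>
    (\<Sum>n\<le>m. shifts L N n) = (\<Sum>n\<le>m. N n) - of_nat (\<Sum>\<beta>\<leftarrow>L. root_coeff \<beta> m)"
proof (induction L)
  case (Cons \<beta> L)
  then show ?case by (cases \<beta>) (simp add: sum_shift del: root_coeff.simps)
qed simp

lemma half_integer_shifts:
  "\<forall>n. N n - 1/2 \<in> \<int> \<Longrightarrow> shifts L N n - 1/2 \<in> \<int>"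
proof (induction L arbitrary: n)
  case (Cons \<beta> L)
  obtain a b where \<beta>: "\<beta> = (a, b)" by (cases \<beta>)
  have "shifts (\<beta> # L) N n - 1/2 = (shifts L N n - 1/2) - of_bool (n = a) + of_bool (n = b)"
    by (simp add: \<beta> shift_apply)
  then show ?case using Cons by (simp only: Ints_add Ints_diff) auto
qed simp

lemma half_integer_nonzero:
  assumes "z - 1/2 \<in> \<int>"
  shows "(z :: complex) \<noteq> 0"
proof
  assume "z = 0"
  then obtain k :: int where "- (1/2 :: complex) = of_int k"
    using assms by (auto elim: Ints_cases)
  then have "of_int (2 * k) = (of_int (- 1) :: complex)"
    by (simp add: field_simps)
  then have "2 * k = - 1" by (simp only: of_int_eq_iff)
  then show False by presburger
qed

text \<open>Half-integral exponents stay half-integral under the operators, hence never vanish.\<close>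

lemma act_free_prod_half_integer:
  assumes "\<forall>n. N n - 1/2 \<in> \<int>" "\<forall>(a, b)\<in>set L. a < b"
  shows "\<exists>c. c \<noteq> 0 \<and> (\<forall>g. act (free_prod L) g N = c * g (shifts L N))"
  using assms(2)
proof (induction L)
  case Nil
  show ?case by (rule exI[of _ 1]) simp
next
  case (Cons \<beta> L)
  obtain a b where \<beta>: "\<beta> = (a, b)" by (cases \<beta>)
  obtain c where c: "c \<noteq> 0" "\<And>g. act (free_prod L) g N = c * g (shifts L N)"
    using Cons by auto
  show ?case
  proof (intro exI[of _ "c * shifts L N a"] conjI allI)
    show "c * shifts L N a \<noteq> 0"
      using c(1) half_integer_nonzero[OF half_integer_shifts[OF assms(1)]] by simp
    fix g
    show "act (free_prod (\<beta> # L)) g N = c * shifts L N a * g (shifts (\<beta> # L) N)"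
      using Cons.prems by (simp add: act_mult c(2) \<beta> act_free_root lowering_def)
  qed
qed

text \<open>A word is a product of simple root vectors. Since \<open>N\<close> is arbitrary here,
  the scalar \<open>c\<close> may be zero.\<close>

lemma word_op_shifts:
  "\<exists>c. \<forall>g. word_op w g N = c * g (shifts (map (\<lambda>m. (m, Suc m)) w) N)"
proof (induction w)
  case Nil
  show ?case by (rule exI[of _ 1]) simp
next
  case (Cons m w)
  then obtain c where "\<And>g. word_op w g N = c * g (shifts (map (\<lambda>m. (m, Suc m)) w) N)" by blast
  then show ?case
    by (intro exI[of _ "c * shifts (map (\<lambda>m. (m, Suc m)) w) N m"])
      (simp add: word_op_Cons lowering_def)
qed

lemma count_list_eq_sum_root_coeff:
  "(\<Sum>\<beta>\<leftarrow>map (\<lambda>m. (m, Suc m)) w. root_coeff \<beta> m) = count_list w m"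
  by (induction w) auto

text \<open>Test both elements at a half-integral \<open>N\<close> with the indicator of the
  exponent that \<open>L\<close> reaches. Some word of \<open>y\<close> must reach the same
  exponent, and partial sums of exponents recover its letter counts.\<close>

lemma free_prod_content:
  assumes L: "\<forall>(a, b)\<in>set L. a < b"
    and eq: "\<And>g N. act (free_prod L) g N = act y g N"
  obtains w where "w \<in> Poly_Mapping.keys y" "\<And>m. count_list w m = (\<Sum>\<beta>\<leftarrow>L. root_coeff \<beta> m)"
proof -
  define N :: exvec where "N = (\<lambda>n. 1/2)"
  define g :: "exvec \<Rightarrow> complex" where "g = (\<lambda>M. of_bool (M = shifts L N))"
  obtain c where "c \<noteq> 0" "act (free_prod L) g N = c * g (shifts L N)"
    using act_free_prod_half_integer[OF _ L, of N] by (auto simp: N_def)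
  then have "act y g N \<noteq> 0" using eq[of g N] by (simp add: g_def)
  then have "\<exists>w\<in>Poly_Mapping.keys y. word_op w g N \<noteq> 0"
    unfolding act_def by (rule contrapos_np) (simp add: sum.neutral)
  then obtain w where w: "w \<in> Poly_Mapping.keys y" "word_op w g N \<noteq> 0" by blast
  obtain d where "word_op w g N = d * g (shifts (map (\<lambda>m. (m, Suc m)) w) N)"
    using word_op_shifts by blast
  then have shifts: "shifts (map (\<lambda>m. (m, Suc m)) w) N = shifts L N"
    using w(2) by (auto simp: g_def)
  have "count_list w m = (\<Sum>\<beta>\<leftarrow>L. root_coeff \<beta> m)" for m
  proof -
    have "(\<Sum>n\<le>m. shifts (map (\<lambda>m. (m, Suc m)) w) N n) = (\<Sum>n\<le>m. N n) - of_nat (count_list w m)"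
      by (subst sum_shifts) (auto simp: count_list_eq_sum_root_coeff simp del: map_map)
    with sum_shifts[OF L, of N m] have "of_nat (count_list w m) = (of_nat (\<Sum>\<beta>\<leftarrow>L. root_coeff \<beta> m) :: complex)"
      by (simp add: shifts)
    then show ?thesis by (simp only: of_nat_eq_iff)
  qed
  with w(1) that show thesis by blast
qed


section \<open>Chains of roots\<close>

fun chain :: "nat \<Rightarrow> (nat \<times> nat) list \<Rightarrow> nat \<Rightarrow> bool" where
  "chain i [] j \<longleftrightarrow> i = j"
| "chain i (\<beta> # L) j \<longleftrightarrow> fst \<beta> = i \<and> i < snd \<beta> \<and> chain (snd \<beta>) L j"

lemma chain_le: "chain i L j \<Longrightarrow> i \<le> j"
  by (induction L arbitrary: i) (auto intro: less_imp_le less_le_trans)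

lemma chain_append: "chain i (L @ L') k \<longleftrightarrow> (\<exists>j. chain i L j \<and> chain j L' k)"
  by (induction L arbitrary: i) auto

lemma chain_root_bounds:
  assumes "chain i L j" "(a, b) \<in> set L"
  shows "i \<le> a" "a < b" "b \<le> j"
proof -
  obtain L1 L2 where "L = L1 @ (a, b) # L2" using assms(2) split_list by metis
  then show "i \<le> a" "a < b" "b \<le> j"
    using assms(1) by (auto simp: chain_append dest: chain_le)
qed

lemma chain_starts_sorted: "chain i L j \<Longrightarrow> sorted_wrt (<) (map fst L)"
proof (induction L arbitrary: i)
  case (Cons \<beta> L)
  have "fst \<beta> < fst \<gamma>" if "\<gamma> \<in> set L" for \<gamma>
    using chain_root_bounds[of "snd \<beta>" L j "fst \<gamma>" "snd \<gamma>"] Cons.prems that by auto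
  then show ?case using Cons by auto
qed simp

text \<open>Each step ends where the next one starts and the last step ends at \<open>j\<close>, so
  the starts determine the chain.\<close>

lemma chain_eq_zip: "chain i L j \<Longrightarrow> L = zip (map fst L) (tl (map fst L) @ [j])"
proof (induction L arbitrary: i)
  case (Cons \<beta> L)
  then show ?case by (cases L) (auto simp: prod_eq_iff)
qed simp

lemma chain_determined_by_starts:
  assumes "chain i L j" "chain i' L' j" "fst ` set L = fst ` set L'"
  shows "L = L'"
proof -
  have "map fst L = map fst L'"
    using chain_starts_sorted[OF assms(1)] chain_starts_sorted[OF assms(2)] assms(3)
    by (intro strict_sorted_equal) auto
  then show ?thesis using chain_eq_zip[OF assms(1)] chain_eq_zip[OF assms(2)] by metis
qed

lemma chain_length:
  assumes "chain i L j"
  shows "length L = card (fst ` set L)"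
proof -
  have "distinct (map fst L)"
    using chain_starts_sorted[OF assms] strict_sorted_iff by blast
  then show ?thesis by (metis distinct_card length_map list.set_map)
qed

text \<open>Factors further to the right act first on the monomial and change exponents only from
  the end \<open>b\<close> of the first step onwards. The factor for \<open>(i, b)\<close> therefore
  still sees the original \<open>N i\<close>.\<close>

lemma act_chain:
  "chain i L j \<Longrightarrow> act (free_prod L) g N = (\<Prod>\<beta>\<leftarrow>L. N (fst \<beta>)) * g (shift i j N)"
proof (induction L arbitrary: i g)
  case (Cons \<beta> L)
  obtain b where \<beta>: "\<beta> = (i, b)" and b: "i < b" "chain b L j"
    using Cons.prems by (cases \<beta>) auto
  have "act (free_root (i, b)) g = lowering i b g"
    using b(1) by (simp add: fun_eq_iff act_free_root)
  then have "act (free_prod (\<beta> # L)) g N = act (free_prod L) (lowering i b g) N"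
    by (simp add: act_mult \<beta>)
  also have "\<dots> = (\<Prod>\<beta>\<leftarrow>L. N (fst \<beta>)) * (N i * g (shift i j N))"
    using b(1) chain_le[OF b(2)]
    by (simp add: Cons.IH[OF b(2)] lowering_def shift_shift) (simp add: shift_apply)
  finally show ?case by (simp add: \<beta>)
qed simp

lemma chain_content:
  "chain i L j \<Longrightarrow> (\<Sum>\<beta>\<leftarrow>L. root_coeff \<beta> m) = root_coeff (i, j) m"
proof (induction L arbitrary: i)
  case (Cons \<beta> L)
  obtain b where \<beta>: "\<beta> = (i, b)" and b: "i < b" "chain b L j"
    using Cons.prems by (cases \<beta>) auto
  show ?case using b(1) chain_le[OF b(2)] by (simp add: \<beta> Cons.IH[OF b(2)])
qed simp

lemma chain_sorted: "chain i L j \<Longrightarrow> sorted L"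
proof -
  assume "chain i L j"
  then have "sorted_wrt (\<lambda>\<beta> \<gamma>. fst \<beta> < fst \<gamma>) L"
    using chain_starts_sorted by (simp add: sorted_wrt_map)
  then show ?thesis by (rule sorted_wrt_mono_rel[rotated]) (auto simp: less_eq_prod_def)
qed

text \<open>The first root of a sorted list has the least start, which must be \<open>i\<close>
  because \<open>i\<close> occurs in the content. Removing that root \<open>(i, b)\<close> leaves
  the content of \<open>(b, j)\<close>.\<close>

lemma sorted_content_imp_chain:
  assumes "sorted L" "\<forall>(a, b)\<in>set L. a < b" "i \<le> j"
    and "\<And>m. (\<Sum>\<beta>\<leftarrow>L. root_coeff \<beta> m) = root_coeff (i, j) m"
  shows "chain i L j"
  using assms
proof (induction L arbitrary: i)
  case Nil
  then show ?case using Nil(4)[of i] by (auto split: if_splits)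
next
  case (Cons \<beta> L)
  obtain a b where \<beta>: "\<beta> = (a, b)" by (cases \<beta>)
  have ab: "a < b" using Cons.prems(2) by (simp add: \<beta>)
  have sum: "root_coeff (a, b) m + (\<Sum>\<gamma>\<leftarrow>L. root_coeff \<gamma> m) = root_coeff (i, j) m" for m
    using Cons.prems(4)[of m] by (simp add: \<beta>)
  have le: "root_coeff (a, b) m \<le> root_coeff (i, j) m" for m using sum[of m] by linarith
  have "i \<le> a" "a < j" using le[of a] ab by (auto split: if_splits)
  have "b \<le> j" using le[of "b - 1"] ab by (auto split: if_splits)
  have "a \<le> i"
  proof (rule ccontr)
    assume "\<not> a \<le> i"
    have "root_coeff \<gamma> i = 0" if "\<gamma> \<in> set (\<beta> # L)" for \<gamma>
    proof -
      have "a \<le> fst \<gamma>"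
        using that Cons.prems(1) by (auto simp: \<beta> less_eq_prod_def)
      then show ?thesis using \<open>\<not> a \<le> i\<close> by (cases \<gamma>) auto
    qed
    then have "(\<Sum>\<gamma>\<leftarrow>\<beta> # L. root_coeff \<gamma> i) = 0"
      by (simp add: sum_list_eq_0_iff)
    then show False
      using Cons.prems(4)[of i] \<open>i \<le> a\<close> \<open>a < j\<close> by (simp del: list.map sum_list.Cons)
  qed
  with \<open>i \<le> a\<close> have "a = i" by simp
  have "chain b L j"
  proof (rule Cons.IH)
    show "(\<Sum>\<gamma>\<leftarrow>L. root_coeff \<gamma> m) = root_coeff (b, j) m" for m
      using sum[of m] ab \<open>b \<le> j\<close> by (auto simp: \<open>a = i\<close> split: if_splits)
  qed (use Cons.prems \<open>b \<le> j\<close> in auto)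
  then show ?case using ab by (simp add: \<beta> \<open>a = i\<close>)
qed

text \<open>Starts increase strictly, so a chain with more than one step has a start different from
  \<open>i\<close>, and its product vanishes.\<close>

lemma prod_list_starts_indicator:
  assumes "chain i L j" "i < j"
  shows "(\<Prod>\<beta>\<leftarrow>L. of_bool (fst \<beta> = i)) = (of_bool (L = [(i, j)]) :: complex)"
proof (cases L)
  case Nil
  with assms show ?thesis by simp
next
  case (Cons \<beta> L')
  then show ?thesis
    using assms by (cases L') (auto simp: prod_eq_iff)
qed


section \<open>The free algebra and its quotient as rings\<close>

lemma keys_uminus: "Poly_Mapping.keys (- x) = Poly_Mapping.keys x" for x :: "'a \<Rightarrow>\<^sub>0 'b::ab_group_add"
  by (auto simp: in_keys_iff)

lemma keys_diff_subset: "Poly_Mapping.keys (x - y) \<subseteq> Poly_Mapping.keys x \<union> Poly_Mapping.keys y"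
  for x y :: "'a \<Rightarrow>\<^sub>0 'b::ab_group_add"
  using keys_add[of x "- y"] by (simp add: keys_uminus)

lemma keys_mult_words:
  "Poly_Mapping.keys (x * y) \<subseteq> {u @ v | u v. u \<in> Poly_Mapping.keys x \<and> v \<in> Poly_Mapping.keys y}"
  for x y :: falg
  using keys_mult[of x y] by (simp add: plus_list_def)

lemma U_free_simps [simp]:
  "x \<otimes>\<^bsub>U_free r\<^esub> y = x * y" "\<one>\<^bsub>U_free r\<^esub> = 1" "x \<oplus>\<^bsub>U_free r\<^esub> y = x + y" "\<zero>\<^bsub>U_free r\<^esub> = 0"
  "c \<odot>\<^bsub>U_free r\<^esub> x = Poly_Mapping.single [] c * x"
  by (simp_all add: U_free_def)

lemma U_free_carrier_iff:
  "x \<in> carrier (U_free r) \<longleftrightarrow> (\<forall>w\<in>Poly_Mapping.keys x. set w \<subseteq> {1..<r})"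
  by (simp add: U_free_def)

lemma U_free_carrier_intros:
  "0 \<in> carrier (U_free r)" "1 \<in> carrier (U_free r)"
  "set w \<subseteq> {1..<r} \<Longrightarrow> Poly_Mapping.single w c \<in> carrier (U_free r)"
  "m \<in> {1..<r} \<Longrightarrow> fgen m \<in> carrier (U_free r)"
  "x \<in> carrier (U_free r) \<Longrightarrow> - x \<in> carrier (U_free r)"
  "x \<in> carrier (U_free r) \<Longrightarrow> y \<in> carrier (U_free r) \<Longrightarrow> x + y \<in> carrier (U_free r)"
  "x \<in> carrier (U_free r) \<Longrightarrow> y \<in> carrier (U_free r) \<Longrightarrow> x - y \<in> carrier (U_free r)"
  "x \<in> carrier (U_free r) \<Longrightarrow> y \<in> carrier (U_free r) \<Longrightarrow> x * y \<in> carrier (U_free r)"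
  using keys_add[of x y] keys_diff_subset[of x y] keys_mult_words[of x y]
  unfolding U_free_carrier_iff
  by (fastforce simp: keys_uminus zero_list_def fgen_def split: if_splits)+

lemma ring_U_free: "ring (U_free r)"
  by (intro ringI abelian_groupI monoidI)
    (auto simp: algebra_simps intro: U_free_carrier_intros exI[of _ "- x" for x] intro!: bexI[of _ "- x" for x])

lemma U_free_minus:
  assumes "x \<in> carrier (U_free r)" "y \<in> carrier (U_free r)"
  shows "x \<ominus>\<^bsub>U_free r\<^esub> y = x - y"
proof -
  interpret ring "U_free r" by (rule ring_U_free)
  have "\<ominus>\<^bsub>U_free r\<^esub> y = - y"
    using assms by (intro minus_equality) (auto intro: U_free_carrier_intros)
  then show ?thesis by (simp add: a_minus_def)
qed

section \<open>The Serre ideal and the quotient algebra\<close>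

lemma serre_rels_carrier: "serre_rels r \<subseteq> carrier (U_free r)"
proof
  fix s assume "s \<in> serre_rels r"
  then obtain i j where s: "s = ((\<lambda>y. fgen i * y - y * fgen i) ^^ nat (1 - cartan i j)) (fgen j)"
    and ij: "i \<in> {1..<r}" "j \<in> {1..<r}"
    by (auto simp: serre_rels_def)
  have "((\<lambda>y. fgen i * y - y * fgen i) ^^ n) (fgen j) \<in> carrier (U_free r)" for n
    by (induction n) (use ij in \<open>auto intro!: U_free_carrier_intros\<close>)
  then show "s \<in> carrier (U_free r)" by (simp add: s)
qed

lemma ideal_serre_ideal: "ideal (serre_ideal r) (U_free r)"
  unfolding serre_ideal_def by (rule ring.genideal_ideal[OF ring_U_free serre_rels_carrier])

text \<open>The elements acting as zero form a two-sided ideal that contains the Serre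
  relations.\<close>

lemma act_serre_ideal:
  assumes "x \<in> serre_ideal r"
  shows "act x g N = 0"
proof -
  define K where "K = {x \<in> carrier (U_free r). \<forall>g N. act x g N = 0}"
  interpret ring "U_free r" by (rule ring_U_free)
  have op: "act x g = (\<lambda>N. 0)" if "x \<in> K" for x g
    using that by (simp add: K_def fun_eq_iff)
  have uminus: "act (- x) g N = - act x g N" for x g N
    using act_add[of "- x" x g N] by (simp add: eq_neg_iff_add_eq_0)
  have "ideal K (U_free r)"
  proof (rule idealI)
    show "subgroup K (add_monoid (U_free r))"
    proof (rule add.subgroupI)
      show "K \<noteq> {}" by (auto simp: K_def intro: U_free_carrier_intros)
      show "\<ominus>\<^bsub>U_free r\<^esub> x \<in> K" if "x \<in> K" for x
        using that U_free_minus[of 0 r x]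
        by (simp add: K_def uminus a_minus_def U_free_carrier_intros)
    qed (auto simp: K_def act_add intro: U_free_carrier_intros)
    show "x \<otimes>\<^bsub>U_free r\<^esub> a \<in> K" if "a \<in> K" "x \<in> carrier (U_free r)" for a x
      using that by (auto simp: K_def act_mult intro: U_free_carrier_intros)
    show "a \<otimes>\<^bsub>U_free r\<^esub> x \<in> K" if "a \<in> K" "x \<in> carrier (U_free r)" for a x
      using that op[OF that(1)]
      by (auto simp: K_def act_mult act_fun_zero intro: U_free_carrier_intros)
  qed (rule ring_U_free)
  moreover have "serre_rels r \<subseteq> K"
    using serre_rels_carrier act_serre_rels by (auto simp: K_def)
  ultimately have "serre_ideal r \<subseteq> K"
    unfolding serre_ideal_def by (rule genideal_minimal)
  with assms show ?thesis by (auto simp: K_def)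
qed

lemma serre_ideal_intros:
  "0 \<in> serre_ideal r"
  "x \<in> serre_ideal r \<Longrightarrow> y \<in> serre_ideal r \<Longrightarrow> x + y \<in> serre_ideal r"
  "x \<in> serre_ideal r \<Longrightarrow> y \<in> carrier (U_free r) \<Longrightarrow> x * y \<in> serre_ideal r"
  "x \<in> serre_ideal r \<Longrightarrow> y \<in> carrier (U_free r) \<Longrightarrow> y * x \<in> serre_ideal r"
proof -
  interpret ideal "serre_ideal r" "U_free r" by (rule ideal_serre_ideal)
  show "0 \<in> serre_ideal r" using additive_subgroup.zero_closed[OF is_additive_subgroup] by simp
  show "x \<in> serre_ideal r \<Longrightarrow> y \<in> serre_ideal r \<Longrightarrow> x + y \<in> serre_ideal r"
    using additive_subgroup.a_closed[OF is_additive_subgroup, of x y] by simp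
  show "x \<in> serre_ideal r \<Longrightarrow> y \<in> carrier (U_free r) \<Longrightarrow> x * y \<in> serre_ideal r"
    using I_r_closed[of x y] by simp
  show "x \<in> serre_ideal r \<Longrightarrow> y \<in> carrier (U_free r) \<Longrightarrow> y * x \<in> serre_ideal r"
    using I_l_closed[of x y] by simp
qed

lemma qmap_eq_iff:
  "x \<in> carrier (U_free r) \<Longrightarrow> y \<in> carrier (U_free r) \<Longrightarrow>
    qmap r x = qmap r y \<longleftrightarrow> x - y \<in> serre_ideal r"
  using ring.quotient_eq_iff_same_a_r_cos[OF ring_U_free ideal_serre_ideal, of x r y]
  by (simp add: qmap_def U_free_minus)

text \<open>The action descends to the quotient; equations between cosets are tested through this
  fact.\<close>

lemma act_qmap_eq:
  "x \<in> carrier (U_free r) \<Longrightarrow> y \<in> carrier (U_free r) \<Longrightarrow> qmap r x = qmap r y \<Longrightarrow>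
    act x g N = act y g N"
  using act_serre_ideal[of "x - y" r g N] by (simp add: qmap_eq_iff act_diff)

lemma ring_extend: "ring R \<Longrightarrow> ring (ring.extend R m)"
proof -
  assume "ring R"
  then interpret ring R .
  show ?thesis
    by (intro ringI abelian_groupI monoidI)
      (auto simp: ring.defs m_assoc a_ac l_distr r_distr
        intro: add.inv_closed l_neg intro!: bexI[of _ "\<ominus>\<^bsub>R\<^esub> x" for x])
qed

lemma ring_U_nminus: "ring (U_nminus r)"
  unfolding U_nminus_def by (rule ring_extend[OF ideal.quotient_is_ring[OF ideal_serre_ideal]])

lemma qmap_ring_hom: "ring_hom_ring (U_free r) (U_nminus r) (qmap r)"
proof (rule ring_hom_ringI2[OF ring_U_free ring_U_nminus])
  have hom: "qmap r \<in> ring_hom (U_free r) (U_free r Quot serre_ideal r)"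
    unfolding qmap_def by (rule ideal.rcos_ring_hom[OF ideal_serre_ideal])
  show "qmap r \<in> ring_hom (U_free r) (U_nminus r)"
    using ring_hom_closed[OF hom] ring_hom_mult[OF hom] ring_hom_add[OF hom] ring_hom_one[OF hom]
    by (intro ring_hom_memI) (simp_all add: U_nminus_def ring.defs)
qed

lemma U_nminus_carrier: "carrier (U_nminus r) = qmap r ` carrier (U_free r)"
  by (auto simp: U_nminus_def ring.defs FactRing_def A_RCOSETS_def RCOSETS_def qmap_def a_r_coset_def)

lemma qmap_mult:
  "x \<in> carrier (U_free r) \<Longrightarrow> y \<in> carrier (U_free r) \<Longrightarrow>
    qmap r x \<otimes>\<^bsub>U_nminus r\<^esub> qmap r y = qmap r (x * y)"
  using ring_hom_mult[OF ring_hom_ring.homh[OF qmap_ring_hom]] by simp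

lemma qmap_add:
  "x \<in> carrier (U_free r) \<Longrightarrow> y \<in> carrier (U_free r) \<Longrightarrow>
    qmap r x \<oplus>\<^bsub>U_nminus r\<^esub> qmap r y = qmap r (x + y)"
  using ring_hom_add[OF ring_hom_ring.homh[OF qmap_ring_hom]] by simp

lemma qmap_one: "\<one>\<^bsub>U_nminus r\<^esub> = qmap r 1"
  using ring_hom_one[OF ring_hom_ring.homh[OF qmap_ring_hom]] by simp

text \<open>Scalar multiplication is defined as a union over representatives. All of them give the
  same coset because the ideal absorbs constants.\<close>

lemma qmap_smult:
  assumes "x \<in> carrier (U_free r)"
  shows "c \<odot>\<^bsub>U_nminus r\<^esub> qmap r x = qmap r (Poly_Mapping.single [] c * x)"
proof -
  interpret ideal "serre_ideal r" "U_free r" by (rule ideal_serre_ideal)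
  have single: "Poly_Mapping.single [] c \<in> carrier (U_free r)"
    by (simp add: U_free_carrier_intros)
  have "qmap r (Poly_Mapping.single [] c * y) = qmap r (Poly_Mapping.single [] c * x)"
    if y: "y \<in> qmap r x" for y
  proof -
    obtain h where h: "h \<in> serre_ideal r" "y = h + x"
      using y by (auto simp: qmap_def a_r_coset_def r_coset_def)
    have "h \<in> carrier (U_free r)" using h(1) by (rule a_Hcarr)
    then show ?thesis
      using assms single h serre_ideal_intros(4)[OF h(1) single]
      by (subst qmap_eq_iff) (auto simp: distrib_left intro: U_free_carrier_intros)
  qed
  moreover have "x \<in> qmap r x"
    unfolding qmap_def using assms by (rule a_rcos_self)
  ultimately have "(\<Union>y\<in>qmap r x. qmap r (Poly_Mapping.single [] c * y)) = qmap r (Poly_Mapping.single [] c * x)"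
    by (intro SUP_eq_const) blast+
  then show ?thesis by (simp add: U_nminus_def ring.defs)
qed

lemma qmap_bracket:
  assumes "x \<in> carrier (U_free r)" "y \<in> carrier (U_free r)"
  shows "bracket (U_nminus r) (qmap r x) (qmap r y) = qmap r (x * y - y * x)"
proof -
  interpret ring_hom_ring "U_free r" "U_nminus r" "qmap r" by (rule qmap_ring_hom)
  have "x * y - y * x = x * y \<ominus>\<^bsub>U_free r\<^esub> y * x"
    using assms by (simp add: U_free_minus U_free_carrier_intros)
  moreover have "x * y \<in> carrier (U_free r)" "y * x \<in> carrier (U_free r)"
    using assms by (auto intro: U_free_carrier_intros)
  ultimately show ?thesis
    using assms by (simp add: bracket_def qmap_mult a_minus_def flip: U_free_simps(3))
qed

section \<open>Lifts of root vectors and of PBW monomials\<close>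

lemma free_root_carrier:
  "1 \<le> i \<Longrightarrow> i < j \<Longrightarrow> j \<le> r \<Longrightarrow> free_root (i, j) \<in> carrier (U_free r)"
proof (induction j)
  case (Suc j)
  then show ?case
    by (cases "i = j") (auto simp: free_root_simple free_root_Suc intro!: U_free_carrier_intros)
qed simp

lemma root_vec_eq: "1 \<le> i \<Longrightarrow> i < j \<Longrightarrow> j \<le> r \<Longrightarrow> root_vec r (i, j) = qmap r (free_root (i, j))"
proof (induction j)
  case (Suc j)
  show ?case
  proof (cases "i = j")
    case True
    then show ?thesis by (simp add: free_root_simple)
  next
    case False
    have "root_vec r (i, Suc j) = bracket (U_nminus r) (qmap r (fgen j)) (root_vec r (i, j))"
      using Suc.prems False by simp
    with Suc False show ?thesis
      by (simp add: qmap_bracket free_root_Suc free_root_carrier U_free_carrier_intros del: root_vec.simps)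
  qed
qed simp

lemma set_pos_roots: "set (pos_roots r) = {(i, j). 1 \<le> i \<and> i < j \<and> j \<le> r}"
proof -
  have "set (pos_roots r) = (\<Union>i\<in>{1..<r}. Pair i ` {Suc i..<Suc r})"
    by (simp add: pos_roots_def del: upt_Suc)
  then show ?thesis by (auto simp: image_iff)
qed

text \<open>Writes an exponent function as the increasing list of its roots with multiplicity, so
  that PBW monomials can be compared with chains.\<close>

definition expand :: "nat \<Rightarrow> (nat \<times> nat \<Rightarrow> nat) \<Rightarrow> (nat \<times> nat) list" where
  "expand r p = concat (map (\<lambda>\<beta>. replicate (p \<beta>) \<beta>) (pos_roots r))"

lemma set_expand: "set (expand r p) \<subseteq> set (pos_roots r)"
  by (auto simp: expand_def)

lemma free_prod_carrier: "set L \<subseteq> set (pos_roots r) \<Longrightarrow> free_prod L \<in> carrier (U_free r)"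
  by (induction L) (auto simp: set_pos_roots free_root_carrier U_free_carrier_intros)

lemma pbw_eq: "pbw r p = qmap r (free_prod (expand r p))"
proof -
  interpret ring_hom_ring "U_free r" "U_nminus r" "qmap r" by (rule qmap_ring_hom)
  have pow: "free_root \<beta> [^]\<^bsub>U_free r\<^esub> n = free_prod (replicate n \<beta>)" for \<beta> and n :: nat
    by (induction n) (simp_all add: power_commutes)
  have "foldr (\<lambda>\<beta> X. (root_vec r \<beta> [^]\<^bsub>U_nminus r\<^esub> p \<beta>) \<otimes>\<^bsub>U_nminus r\<^esub> X) B \<one>\<^bsub>U_nminus r\<^esub>
      = qmap r (free_prod (concat (map (\<lambda>\<beta>. replicate (p \<beta>) \<beta>) B)))"
    if "set B \<subseteq> set (pos_roots r)" for B
    using that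
  proof (induction B)
    case Nil
    then show ?case by (simp add: qmap_one)
  next
    case (Cons \<beta> B)
    have root: "root_vec r \<beta> = qmap r (free_root \<beta>)" "free_root \<beta> \<in> carrier (U_free r)"
      using Cons.prems root_vec_eq[of "fst \<beta>" "snd \<beta>"] free_root_carrier[of "fst \<beta>" "snd \<beta>"]
      by (auto simp: set_pos_roots)
    have carrier: "free_prod (replicate (p \<beta>) \<beta>) \<in> carrier (U_free r)"
      "free_prod (concat (map (\<lambda>\<beta>. replicate (p \<beta>) \<beta>) B)) \<in> carrier (U_free r)"
      using Cons.prems by (intro free_prod_carrier; auto)+
    have "root_vec r \<beta> [^]\<^bsub>U_nminus r\<^esub> p \<beta> = qmap r (free_prod (replicate (p \<beta>) \<beta>))"
      using root hom_nat_pow[of "free_root \<beta>" "p \<beta>"] by (simp only: pow)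
    then show ?case
      using Cons carrier by (simp add: qmap_mult del: prod_list_replicate map_replicate)
  qed
  then show ?thesis by (simp add: pbw_def expand_def)
qed


section \<open>Content\<close>

text \<open>Each commutator puts the new letter \<open>j\<close> at one end of a word.\<close>

lemma free_root_content:
  "i < j \<Longrightarrow> w \<in> Poly_Mapping.keys (free_root (i, j)) \<Longrightarrow> count_list w m = root_coeff (i, j) m"
proof (induction j arbitrary: w)
  case (Suc j)
  show ?case
  proof (cases "i = j")
    case True
    then show ?thesis using Suc.prems(2) by (auto simp: free_root_simple fgen_def)
  next
    case False
    have keys: "Poly_Mapping.keys (fgen j) = {[j]}" by (simp add: fgen_def)
    have "w \<in> Poly_Mapping.keys (fgen j * free_root (i, j)) \<union> Poly_Mapping.keys (free_root (i, j) * fgen j)"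
      using Suc.prems False keys_diff_subset[of "fgen j * free_root (i, j)" "free_root (i, j) * fgen j"]
      by (auto simp: free_root_Suc)
    then obtain v where "v \<in> Poly_Mapping.keys (free_root (i, j))" "w = j # v \<or> w = v @ [j]"
      using keys_mult_words[of "fgen j" "free_root (i, j)"] keys_mult_words[of "free_root (i, j)" "fgen j"]
      by (auto simp: keys)
    with Suc.IH[of v] Suc.prems False show ?thesis by auto
  qed
qed simp

lemma free_prod_keys_content:
  "\<forall>(a, b)\<in>set L. a < b \<Longrightarrow> w \<in> Poly_Mapping.keys (free_prod L) \<Longrightarrow>
    count_list w m = (\<Sum>\<beta>\<leftarrow>L. root_coeff \<beta> m)"
proof (induction L arbitrary: w)
  case Nil
  then show ?case by (simp add: zero_list_def)
next
  case (Cons \<beta> L)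
  obtain a b where \<beta>: "\<beta> = (a, b)" by (cases \<beta>)
  obtain u v where "u \<in> Poly_Mapping.keys (free_root \<beta>)" "v \<in> Poly_Mapping.keys (free_prod L)" "w = u @ v"
    using Cons.prems(2) keys_mult_words[of "free_root \<beta>" "free_prod L"] by auto
  with Cons show ?case by (auto simp: \<beta> free_root_content simp del: root_coeff.simps)
qed

section \<open>Exponent functions as sorted lists of roots\<close>

lemma sorted_pos_roots: "sorted (pos_roots r)"
proof -
  have "sorted (concat (map (\<lambda>i. map (Pair i) (f i)) xs))"
    if "sorted_wrt (<) xs" "\<And>i. sorted (f i)" for xs :: "nat list" and f :: "nat \<Rightarrow> nat list"
    using that(1)
  proof (induction xs)
    case (Cons i xs)
    have "sorted (map (Pair i) (f i))"
      using that(2)[of i] unfolding sorted_map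
      by (rule sorted_wrt_mono_rel[rotated]) (simp add: less_eq_prod_def)
    moreover have "x \<le> y" if "x \<in> set (map (Pair i) (f i))"
      "y \<in> set (concat (map (\<lambda>i. map (Pair i) (f i)) xs))" for x y
      using that Cons.prems by (auto simp: less_eq_prod_def)
    ultimately show ?case using Cons by (simp add: sorted_append)
  qed simp
  then show ?thesis by (simp add: pos_roots_def del: upt_Suc)
qed

lemma distinct_pos_roots: "distinct (pos_roots r)"
proof -
  have "distinct (concat (map (\<lambda>i. map (Pair i) (f i)) xs))"
    if "distinct xs" "\<And>i. distinct (f i)" for xs :: "nat list" and f :: "nat \<Rightarrow> nat list"
    using that(1) by (induction xs) (auto simp: distinct_map inj_on_def that(2))
  then show ?thesis by (simp add: pos_roots_def del: upt_Suc)
qed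

lemma count_concat_replicate:
  "distinct B \<Longrightarrow>
    count_list (concat (map (\<lambda>\<beta>. replicate (p \<beta>) \<beta>) B)) x = (if x \<in> set B then p x else 0)"
proof (induction B)
  case (Cons \<beta> B)
  have "count_list (replicate n \<beta>) x = (if x = \<beta> then n else 0)" for n
    by (induction n) auto
  with Cons show ?case by auto
qed simp

lemma count_expand:
  "p \<in> exponents r \<Longrightarrow> count_list (expand r p) \<beta> = p \<beta>"
  unfolding expand_def count_concat_replicate[OF distinct_pos_roots] by (cases \<beta>) (auto simp: exponents_def)

lemma sorted_expand: "sorted (expand r p)"
proof -
  have "sorted (concat (map (\<lambda>\<beta>. replicate (p \<beta>) \<beta>) B))" if "sorted B" for B
    using that by (induction B) (auto simp: sorted_append sorted_replicate)
  then show ?thesis by (simp add: expand_def sorted_pos_roots)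
qed

lemma expand_inj: "p \<in> exponents r \<Longrightarrow> p' \<in> exponents r \<Longrightarrow> expand r p = expand r p' \<Longrightarrow> p = p'"
  using count_expand by (metis ext)

text \<open>Multiplicity inverts \<open>expand\<close>, since a sorted list is determined by its
  multiset.\<close>

lemma expand_count_list:
  assumes "sorted L" "set L \<subseteq> set (pos_roots r)"
  shows "count_list L \<in> exponents r" "expand r (count_list L) = L"
proof -
  show exp: "count_list L \<in> exponents r"
    using assms(2) by (auto simp: exponents_def count_list_0_iff)
  have "mset (expand r (count_list L)) = mset L"
    by (rule multiset_eqI) (simp add: count_mset count_expand[OF exp])
  then show "expand r (count_list L) = L"
    using assms(1) sorted_expand by (metis properties_for_sort)
qed

text \<open>Content concerns a coset and not a chosen lift, so from left to right it is read off the
  action. From right to left, the lift itself is homogeneous.\<close>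

lemma has_content_pbw_iff:
  assumes "1 \<le> i" "i < j" "j \<le> r"
  shows "has_content r (root_coeff (i, j)) (pbw r p) \<longleftrightarrow> chain i (expand r p) j"
proof
  let ?L = "expand r p"
  have L: "\<forall>(a, b)\<in>set ?L. a < b"
    using set_expand[of r p] by (auto simp: set_pos_roots)
  {
    assume "has_content r (root_coeff (i, j)) (pbw r p)"
    then obtain y where y: "y \<in> U_deg r (root_coeff (i, j))" "qmap r (free_prod ?L) = qmap r y"
      by (auto simp: has_content_def pbw_eq)
    have "y \<in> carrier (U_free r)" using y(1) by (simp add: U_deg_def)
    then have eq: "act (free_prod ?L) g N = act y g N" for g N
      using y(2) by (intro act_qmap_eq[of _ r] free_prod_carrier set_expand)
    obtain w where w: "w \<in> Poly_Mapping.keys y" "\<And>m. count_list w m = (\<Sum>\<beta>\<leftarrow>?L. root_coeff \<beta> m)"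
      by (rule free_prod_content[OF L eq]) blast
    have "set w \<subseteq> {1..<r}" using w(1) y(1) by (auto simp: U_deg_def U_free_carrier_iff)
    have "(\<Sum>\<beta>\<leftarrow>?L. root_coeff \<beta> m) = root_coeff (i, j) m" for m
    \<comment> \<open>\<open>U_deg\<close> constrains only letters in \<open>{1..<r}\<close>; for
      other \<open>m\<close> both sides are zero.\<close>
    proof (cases "m \<in> {1..<r}")
      case True
      then have "count_list w m = root_coeff (i, j) m"
        using w(1) y(1) by (simp add: U_deg_def del: root_coeff.simps)
      then show ?thesis by (simp only: w(2))
    next
      case False
      then have "count_list w m = 0"
        using \<open>set w \<subseteq> {1..<r}\<close> by (auto simp: count_list_0_iff)
      moreover have "root_coeff (i, j) m = 0" using False assms by auto
      ultimately show ?thesis by (simp only: w(2))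
    qed
    then show "chain i ?L j"
      using assms(2) by (intro sorted_content_imp_chain sorted_expand L) auto
  }
  assume chain: "chain i ?L j"
  have "free_prod ?L \<in> U_deg r (root_coeff (i, j))"
    using free_prod_carrier[OF set_expand] free_prod_keys_content[OF L]
    by (simp add: U_deg_def chain_content[OF chain] del: root_coeff.simps)
  then show "has_content r (root_coeff (i, j)) (pbw r p)"
    by (auto simp: has_content_def pbw_eq)
qed


section \<open>Spanning\<close>

lemma serre_ideal_carrier: "x \<in> serre_ideal r \<Longrightarrow> x \<in> carrier (U_free r)"
  using additive_subgroup.a_Hcarr[OF ideal.axioms(1)[OF ideal_serre_ideal]] .

lemma serre_ideal_uminus: "x \<in> serre_ideal r \<Longrightarrow> - x \<in> serre_ideal r"
  using serre_ideal_intros(3)[of x r "- 1"] by (simp add: U_free_carrier_intros)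

lemma single_Cons: "Poly_Mapping.single (a # w) (1 :: complex) = fgen a * Poly_Mapping.single w 1"
  and single_append: "Poly_Mapping.single (u @ w) (1 :: complex) = Poly_Mapping.single u 1 * Poly_Mapping.single w 1"
  by (simp_all add: fgen_def mult_single plus_list_def)

lemma single_Nil_one: "Poly_Mapping.single [] (1 :: complex) = 1"
  by (simp add: zero_list_def flip: single_one)

lemma single_Nil_central: "Poly_Mapping.single [] c * x = x * Poly_Mapping.single [] c" for x :: falg
  by (induction x rule: poly_mapping_add_induct)
    (simp_all add: algebra_simps mult_single plus_list_def)

text \<open>Lifts of the elements of the quotient that commute with the generator
  \<open>f_m\<close>.\<close>

definition centralizer :: "nat \<Rightarrow> nat \<Rightarrow> falg set" where
  "centralizer r m = {x \<in> carrier (U_free r). fgen m * x - x * fgen m \<in> serre_ideal r}"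

lemma centralizer_mult:
  assumes "x \<in> centralizer r m" "y \<in> centralizer r m"
  shows "x * y \<in> centralizer r m"
proof -
  \<comment> \<open>The Leibniz rule for the commutator with \<open>fgen m\<close>.\<close>
  have "fgen m * (x * y) - x * y * fgen m
      = (fgen m * x - x * fgen m) * y + x * (fgen m * y - y * fgen m)"
    by (simp add: algebra_simps)
  also have "\<dots> \<in> serre_ideal r"
    using assms by (auto simp: centralizer_def intro: serre_ideal_intros)
  finally show ?thesis
    using assms by (auto simp: centralizer_def intro: U_free_carrier_intros)
qed

lemma centralizer_diff:
  assumes "x \<in> centralizer r m" "y \<in> centralizer r m"
  shows "x - y \<in> centralizer r m"
proof -
  have "fgen m * (x - y) - (x - y) * fgen m
      = (fgen m * x - x * fgen m) + - (fgen m * y - y * fgen m)"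
    by (simp add: algebra_simps)
  also have "\<dots> \<in> serre_ideal r"
    using assms unfolding centralizer_def
    by (intro serre_ideal_intros(2) serre_ideal_uminus) auto
  finally show ?thesis
    using assms by (auto simp: centralizer_def intro: U_free_carrier_intros)
qed

lemma centralizer_one: "1 \<in> centralizer r m"
  by (simp add: centralizer_def U_free_carrier_intros serre_ideal_intros)

text \<open>For non-adjacent indices the Serre relation is the plain commutator.\<close>

lemma centralizer_fgen:
  assumes "1 \<le> a" "Suc a < m" "m < r"
  shows "fgen a \<in> centralizer r m"
proof -
  have "fgen m * fgen a - fgen a * fgen m \<in> serre_rels r"
    unfolding serre_rels_def using assms
    by (intro CollectI exI[of _ m] exI[of _ a]) (auto simp: cartan_def)
  then have "fgen m * fgen a - fgen a * fgen m \<in> serre_ideal r"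
    using ring.genideal_self[OF ring_U_free serre_rels_carrier] by (auto simp: serre_ideal_def)
  then show ?thesis using assms by (simp add: centralizer_def U_free_carrier_intros)
qed

lemma centralizer_word:
  "\<forall>a\<in>set w. 1 \<le> a \<and> Suc a < m \<Longrightarrow> m < r \<Longrightarrow> Poly_Mapping.single w 1 \<in> centralizer r m"
  by (induction w) (auto simp: single_Nil_one single_Cons centralizer_one intro!: centralizer_mult centralizer_fgen)

text \<open>The letters of this root vector are at most \<open>b - 1\<close>, hence at most
  \<open>m - 2\<close>.\<close>

lemma centralizer_free_root:
  "1 \<le> a \<Longrightarrow> a < b \<Longrightarrow> b < m \<Longrightarrow> m < r \<Longrightarrow> free_root (a, b) \<in> centralizer r m"
proof (induction b)
  case (Suc b)
  then show ?case
    by (cases "a = b")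
      (auto simp: free_root_simple free_root_Suc intro!: centralizer_fgen centralizer_mult centralizer_diff)
qed simp

lemma centralizer_free_prod:
  "\<forall>(a, b)\<in>set L. 1 \<le> a \<and> a < b \<and> b < m \<Longrightarrow> m < r \<Longrightarrow> free_prod L \<in> centralizer r m"
  by (induction L) (auto simp: centralizer_one intro!: centralizer_mult centralizer_free_root)

text \<open>Lifts of the linear combinations of chain products in the quotient; \<open>cong\<close>
  builds in the passage modulo the Serre ideal.\<close>

inductive_set chain_span :: "nat \<Rightarrow> nat \<Rightarrow> nat \<Rightarrow> falg set" for r i j where
  base: "chain i L j \<Longrightarrow> free_prod L \<in> chain_span r i j"
| add: "x \<in> chain_span r i j \<Longrightarrow> y \<in> chain_span r i j \<Longrightarrow> x + y \<in> chain_span r i j"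
| scale: "x \<in> chain_span r i j \<Longrightarrow> Poly_Mapping.single [] c * x \<in> chain_span r i j"
| cong: "x \<in> chain_span r i j \<Longrightarrow> y - x \<in> serre_ideal r \<Longrightarrow> y \<in> chain_span r i j"

lemma chain_pos_roots: "chain i L j \<Longrightarrow> 1 \<le> i \<Longrightarrow> j \<le> r \<Longrightarrow> set L \<subseteq> set (pos_roots r)"
  using chain_root_bounds[of i L j] by (fastforce simp: set_pos_roots)

lemma chain_span_carrier:
  assumes "x \<in> chain_span r i j" "1 \<le> i" "j \<le> r"
  shows "x \<in> carrier (U_free r)"
  using assms(1)
proof induction
  case (cong x y)
  then show ?case using U_free_carrier_intros(6)[OF serre_ideal_carrier[of "y - x" r], of x] by simp
qed (use assms(2,3) in \<open>auto intro!: U_free_carrier_intros free_prod_carrier dest: chain_pos_roots\<close>)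

text \<open>Right multiplication appends the step \<open>(j, Suc j)\<close> to each chain.\<close>

lemma chain_span_fgen_right:
  assumes "x \<in> chain_span r i j" "1 \<le> i" "i \<le> j" "j < r"
  shows "x * fgen j \<in> chain_span r i (Suc j)"
  using assms(1)
proof induction
  case (base L)
  then have "chain i (L @ [(j, Suc j)]) (Suc j)" by (simp add: chain_append)
  then have "free_prod (L @ [(j, Suc j)]) \<in> chain_span r i (Suc j)" by (rule chain_span.base)
  then show ?case by (simp add: free_root_simple)
next
  case (add x y)
  then show ?case by (simp add: distrib_right chain_span.add)
next
  case (scale x c)
  then show ?case by (simp add: mult.assoc chain_span.scale)
next
  case (cong x y)
  have "(y - x) * fgen j \<in> serre_ideal r"
    using cong.hyps(2) assms by (intro serre_ideal_intros U_free_carrier_intros) auto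
  then have "y * fgen j - x * fgen j \<in> serre_ideal r" by (simp add: left_diff_distrib)
  with cong.IH show ?case by (rule chain_span.cong)
qed

text \<open>Modulo the ideal, \<open>f_j\<close> passes every step except the last one
  \<open>(c, j)\<close>. There \<open>f_j R = [f_j, R] + R f_j\<close> either lengthens that step to
  \<open>(c, Suc j)\<close> or appends the step \<open>(j, Suc j)\<close>.\<close>

lemma chain_span_fgen_left:
  assumes "x \<in> chain_span r i j" "1 \<le> i" "i \<le> j" "j < r"
  shows "fgen j * x \<in> chain_span r i (Suc j)"
  using assms(1)
proof induction
  case (base L)
  show ?case
  proof (cases L rule: rev_cases)
    case Nil
    then have "chain i [(j, Suc j)] (Suc j)" using base by simp
    from chain_span.base[OF this] Nil show ?thesis by (simp add: free_root_simple)
  next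
    case (snoc L' \<beta>)
    then obtain c where \<beta>: "\<beta> = (c, j)" and c: "chain i L' c" "c < j"
      using base by (cases \<beta>) (auto simp: chain_append)
    define P where "P = free_prod L'"
    define R where "R = free_root (c, j)"
    have roots: "set L' \<subseteq> set (pos_roots r)"
      using chain_pos_roots[OF c(1)] c(2) assms by simp
    have "P \<in> centralizer r j"
      unfolding P_def using chain_root_bounds[OF c(1)] c(2) assms
      by (intro centralizer_free_prod) fastforce+
    moreover have "R \<in> carrier (U_free r)"
      unfolding R_def using chain_le[OF c(1)] c(2) assms by (intro free_root_carrier) auto
    ultimately have ideal: "(fgen j * P - P * fgen j) * R \<in> serre_ideal r"
      by (auto simp: centralizer_def intro: serre_ideal_intros)
    have "free_prod (L' @ [(c, Suc j)]) + free_prod (L' @ [(c, j), (j, Suc j)]) \<in> chain_span r i (Suc j)"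
      using c by (intro chain_span.add chain_span.base) (auto simp: chain_append)
    also have "free_prod (L' @ [(c, Suc j)]) + free_prod (L' @ [(c, j), (j, Suc j)])
        = P * (fgen j * R - R * fgen j) + P * (R * fgen j)"
      using c(2) by (simp add: P_def R_def free_root_simple free_root_Suc)
    finally show ?thesis
    proof (rule chain_span.cong)
      have "fgen j * free_prod L - (P * (fgen j * R - R * fgen j) + P * (R * fgen j))
          = (fgen j * P - P * fgen j) * R"
        by (simp add: snoc \<beta> flip: P_def R_def) (simp add: algebra_simps)
      then show "fgen j * free_prod L - (P * (fgen j * R - R * fgen j) + P * (R * fgen j)) \<in> serre_ideal r"
        using ideal by simp
    qed
  qed
next
  case (add x y)
  then show ?case by (simp add: distrib_left chain_span.add)
next
  case (scale x c)
  have "fgen j * (Poly_Mapping.single [] c * x) = Poly_Mapping.single [] c * (fgen j * x)"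
    by (metis mult.assoc single_Nil_central)
  with scale show ?case by (simp add: chain_span.scale)
next
  case (cong x y)
  have "fgen j * (y - x) \<in> serre_ideal r"
    using cong.hyps(2) assms by (intro serre_ideal_intros U_free_carrier_intros) auto
  then have "fgen j * y - fgen j * x \<in> serre_ideal r" by (simp add: right_diff_distrib)
  with cong.IH show ?case by (rule chain_span.cong)
qed

text \<open>The largest letter commutes with all others but its predecessor, so it can be moved to one of the
  two ends of the word.\<close>

lemma word_in_chain_span:
  assumes "distinct w" "set w = {i..<j}" "1 \<le> i" "i \<le> j" "j \<le> r"
  shows "Poly_Mapping.single w 1 \<in> chain_span r i j"
  using assms(4,1,2,5)
proof (induction j arbitrary: w rule: dec_induct)
  case base
  then have "w = []" by simp
  moreover have "free_prod [] \<in> chain_span r i i" by (rule chain_span.base) simp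
  ultimately show ?case by (simp add: single_Nil_one)
next
  case (step j)
  then have "j \<in> set w" by simp
  then obtain u v where w: "w = u @ j # v" using split_list by metis
  have uv: "distinct (u @ v)" "j \<notin> set u" "j \<notin> set v" "set u \<union> set v = {i..<j}"
  proof -
    show *: "distinct (u @ v)" "j \<notin> set u" "j \<notin> set v"
      using step.prems(1) by (auto simp: w)
    have "insert j (set u \<union> set v) = {i..<Suc j}" using step.prems(2) by (simp add: w)
    moreover have "{i..<Suc j} = insert j {i..<j}" using step.hyps by auto
    ultimately show "set u \<union> set v = {i..<j}" using * by (simp add: insert_ident)
  qed
  define A B where "A = Poly_Mapping.single u (1 :: complex)" and "B = Poly_Mapping.single v (1 :: complex)"
  have AB: "A * B \<in> chain_span r i j"
    using step.IH[of "u @ v"] uv step.prems(3) by (simp add: A_def B_def single_append)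
  have "set u \<subseteq> {i..<j}" "set v \<subseteq> {i..<j}" using uv(4) by blast+
  then have carrier: "A \<in> carrier (U_free r)" "B \<in> carrier (U_free r)"
    using step.prems(3) assms(3) unfolding A_def B_def by (intro U_free_carrier_intros; auto)+
  have word: "Poly_Mapping.single w 1 = A * (fgen j * B)"
    by (simp add: w A_def B_def single_append single_Cons)
  have below: "Suc a < j" if "a \<in> {i..<j}" "a \<noteq> j - 1" for a using that by auto
  \<comment> \<open>The letter \<open>j - 1\<close> cannot lie on both sides of \<open>j\<close>. If
    it is not in \<open>v\<close>, then \<open>j\<close> moves to the right end; otherwise it is not
    in \<open>u\<close>, and \<open>j\<close> moves to the left end.\<close>
  show ?case
  proof (cases "j - 1 \<in> set v")
    case False
    have "B \<in> centralizer r j"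
      unfolding B_def using False \<open>set v \<subseteq> {i..<j}\<close> below assms(3) step.prems(3)
      by (intro centralizer_word) fastforce+
    then have "A * (fgen j * B - B * fgen j) \<in> serre_ideal r"
      using carrier by (auto simp: centralizer_def intro: serre_ideal_intros)
    then have "Poly_Mapping.single w 1 - A * B * fgen j \<in> serre_ideal r"
      by (simp add: word algebra_simps)
    moreover have "A * B * fgen j \<in> chain_span r i (Suc j)"
      using AB step assms(3) by (intro chain_span_fgen_right) auto
    ultimately show ?thesis by (rule chain_span.cong[rotated])
  next
    case True
    then have "j - 1 \<notin> set u" using uv(1) by auto
    then have "A \<in> centralizer r j"
      unfolding A_def using \<open>set u \<subseteq> {i..<j}\<close> below assms(3) step.prems(3)
      by (intro centralizer_word) fastforce+
    then have "- ((fgen j * A - A * fgen j) * B) \<in> serre_ideal r"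
      using carrier by (auto simp: centralizer_def intro: serre_ideal_intros serre_ideal_uminus)
    then have "Poly_Mapping.single w 1 - fgen j * (A * B) \<in> serre_ideal r"
      by (simp add: word algebra_simps)
    moreover have "fgen j * (A * B) \<in> chain_span r i (Suc j)"
      using AB step assms(3) by (intro chain_span_fgen_left) auto
    ultimately show ?thesis by (rule chain_span.cong[rotated])
  qed
qed


section \<open>Tensors\<close>

lemma tensor_eq_refl: "tensor_eq V x x"
  by (simp add: tensor_eq_def tensor_null.null_zero)

lemma tensor_eq_trans: "tensor_eq V x y \<Longrightarrow> tensor_eq V y z \<Longrightarrow> tensor_eq V x z"
  unfolding tensor_eq_def using tensor_null.null_add[of "x - y" V "y - z"] by simp

lemma tensor_eq_add: "tensor_eq V x y \<Longrightarrow> tensor_eq V x' y' \<Longrightarrow> tensor_eq V (x + x') (y + y')"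
  unfolding tensor_eq_def using tensor_null.null_add[of "x - y" V "x' - y'"] by (simp add: algebra_simps)

section \<open>Linear functionals on the tensor product\<close>

definition linear_ext :: "('v \<Rightarrow> ratfun) \<Rightarrow> ('v \<Rightarrow>\<^sub>0 ratfun) \<Rightarrow> ratfun" where
  "linear_ext h x = (\<Sum>v\<in>Poly_Mapping.keys x. Poly_Mapping.lookup x v * h v)"

lemma linear_ext_superset:
  "finite A \<Longrightarrow> Poly_Mapping.keys x \<subseteq> A \<Longrightarrow> linear_ext h x = (\<Sum>v\<in>A. Poly_Mapping.lookup x v * h v)"
  unfolding linear_ext_def by (intro sum.mono_neutral_left) (auto simp: in_keys_iff)

lemma linear_ext_zero [simp]: "linear_ext h 0 = 0"
  by (simp add: linear_ext_def)

lemma linear_ext_add: "linear_ext h (x + y) = linear_ext h x + linear_ext h y"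
  by (simp add: linear_ext_superset[of "Poly_Mapping.keys x \<union> Poly_Mapping.keys y"]
      keys_add lookup_add distrib_right sum.distrib)

lemma linear_ext_diff: "linear_ext h (x - y) = linear_ext h x - linear_ext h y"
  using linear_ext_add[of h "x - y" y] by simp

lemma linear_ext_sum: "linear_ext h (\<Sum>a\<in>A. f a) = (\<Sum>a\<in>A. linear_ext h (f a))"
  by (induction A rule: infinite_finite_induct) (simp_all add: linear_ext_add)

lemma linear_ext_single [simp]: "linear_ext h (Poly_Mapping.single v a) = a * h v"
  by (simp add: linear_ext_superset[of "{v}"])

lemma rconst_add: "rconst (a + b) = rconst a + rconst b"
  by (simp add: rconst_def single_add)

lemma rconst_mult: "rconst (a * b) = rconst a * rconst b"
  by (simp add: rconst_def mult_single)

lemma rconst_one [simp]: "rconst 1 = 1"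
  by (simp add: rconst_def One_fract_def)

lemma rconst_zero [simp]: "rconst 0 = 0"
  by (simp add: rconst_def Zero_fract_def)

lemma rconst_of_bool [simp]: "rconst (of_bool b) = of_bool b"
  by (cases b) simp_all

text \<open>\<open>SOME\<close> picks a representative, and the value on a coset does not depend on
  the choice. \<open>rconst\<close> embeds the number into the coefficient field.\<close>

definition class_act :: "nat \<Rightarrow> (exvec \<Rightarrow> complex) \<Rightarrow> exvec \<Rightarrow> falg set \<Rightarrow> ratfun" where
  "class_act r g N X = rconst (act (SOME x. x \<in> carrier (U_free r) \<and> qmap r x = X) g N)"

lemma class_act_qmap:
  assumes "x \<in> carrier (U_free r)"
  shows "class_act r g N (qmap r x) = rconst (act x g N)"
proof -
  let ?y = "SOME y. y \<in> carrier (U_free r) \<and> qmap r y = qmap r x"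
  have "?y \<in> carrier (U_free r) \<and> qmap r ?y = qmap r x"
    by (rule someI[of _ x]) (simp add: assms)
  then have "act ?y g N = act x g N"
    by (elim conjE) (rule act_qmap_eq[OF _ assms])
  then show ?thesis by (simp only: class_act_def)
qed

lemma act_single_Nil_mult: "act (Poly_Mapping.single [] c * x) g N = c * act x g N"
  by (simp add: act_mult act_single[abs_def] act_fun_scale)

text \<open>The action respects sums and complex multiples, which are the two kinds of tensor
  relations; so the functional is well defined on the tensor product.\<close>

lemma class_act_tensor_null:
  assumes "x \<in> tensor_null (U_nminus r)"
  shows "linear_ext (class_act r g N) x = 0"
  using assms
proof induction
  case (null_additive u v a)
  then obtain x y where "u = qmap r x" "v = qmap r y" "x \<in> carrier (U_free r)" "y \<in> carrier (U_free r)"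
    by (auto simp: U_nminus_carrier)
  then show ?case
    by (simp add: qmap_add linear_ext_diff linear_ext_add class_act_qmap act_add rconst_add algebra_simps U_free_carrier_intros)
next
  case (null_scalar v a c)
  then obtain x where "v = qmap r x" "x \<in> carrier (U_free r)"
    by (auto simp: U_nminus_carrier)
  then show ?case
    by (simp add: qmap_smult linear_ext_diff class_act_qmap act_single_Nil_mult rconst_mult U_free_carrier_intros)
qed (simp_all add: linear_ext_add)

lemma class_act_tensor_eq:
  "tensor_eq (U_nminus r) x y \<Longrightarrow> linear_ext (class_act r g N) x = linear_ext (class_act r g N) y"
  using class_act_tensor_null[of "x - y" r g N] by (simp add: tensor_eq_def linear_ext_diff)

lemma id_tensor_single: "id_tensor \<phi> (pure_tensor a v) = pure_tensor a (\<phi> v)"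
  by (simp add: id_tensor_def)

lemma id_tensor_add: "id_tensor \<phi> (x + y) = id_tensor \<phi> x + id_tensor \<phi> y"
proof -
  have superset: "id_tensor \<phi> z = (\<Sum>v\<in>A. pure_tensor (Poly_Mapping.lookup z v) (\<phi> v))"
    if "finite A" "Poly_Mapping.keys z \<subseteq> A" for z and A
    unfolding id_tensor_def using that by (intro sum.mono_neutral_left) (auto simp: in_keys_iff)
  show ?thesis
    by (simp add: superset[of "Poly_Mapping.keys x \<union> Poly_Mapping.keys y"] keys_add lookup_add
        single_add sum.distrib)
qed

lemma id_tensor_sum: "id_tensor \<phi> (\<Sum>a\<in>A. f a) = (\<Sum>a\<in>A. id_tensor \<phi> (f a))"
proof -
  have "id_tensor \<phi> 0 = 0" by (simp add: id_tensor_def)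
  then show ?thesis
    by (induction A rule: infinite_finite_induct) (simp_all add: id_tensor_add)
qed


section \<open>The coefficient of a root vector\<close>

text \<open>The index set in the definition of \<open>omega\<close> when the content is that of a
  root.\<close>

definition root_monomials :: "nat \<Rightarrow> nat \<Rightarrow> nat \<Rightarrow> (nat \<times> nat \<Rightarrow> nat) set" where
  "root_monomials r i j = {p \<in> exponents r. has_content r (root_coeff (i, j)) (pbw r p)}"

lemma root_monomials_eq:
  "1 \<le> i \<Longrightarrow> i < j \<Longrightarrow> j \<le> r \<Longrightarrow> root_monomials r i j = {p \<in> exponents r. chain i (expand r p) j}"
  unfolding root_monomials_def using has_content_pbw_iff by blast

text \<open>A chain has distinct starts, so it is a duplicate-free list of positive roots, and
  \<open>expand\<close> is injective on exponent functions.\<close>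

lemma finite_root_monomials:
  assumes "1 \<le> i" "i < j" "j \<le> r"
  shows "finite (root_monomials r i j)"
proof (rule finite_imageD)
  have "distinct L" if "chain i L j" for L
  proof -
    have "distinct (map fst L)"
      using chain_starts_sorted[OF that] strict_sorted_iff by blast
    then show ?thesis by (simp add: distinct_map)
  qed
  then have "expand r ` root_monomials r i j \<subseteq> {L. set L \<subseteq> set (pos_roots r) \<and> distinct L}"
    using set_expand by (auto simp: root_monomials_eq[OF assms])
  then show "finite (expand r ` root_monomials r i j)"
    by (rule finite_subset) (simp add: finite_subset_distinct)
  show "inj_on (expand r) (root_monomials r i j)"
    by (rule inj_onI) (auto simp: root_monomials_def intro: expand_inj)
qed

lemma class_act_pbw:
  assumes "chain i (expand r p) j"
  shows "class_act r (\<lambda>_. 1) N (pbw r p) = rconst (\<Prod>\<beta>\<leftarrow>expand r p. N (fst \<beta>))"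
  using assms by (simp add: pbw_eq class_act_qmap free_prod_carrier set_expand act_chain)

lemma prod_list_of_bool: "(\<Prod>x\<leftarrow>xs. of_bool (P x)) = (of_bool (\<forall>x\<in>set xs. P x) :: complex)"
  by (induction xs) auto

text \<open>Evaluating at the indicator function of a set \<open>S\<close> of indices keeps the chains whose starting points
  lie in \<open>S\<close>, which is triangular with respect to the length of chains.\<close>

lemma pbw_independent:
  assumes "1 \<le> i" "i < j" "j \<le> r"
    and eq: "\<And>N. (\<Sum>p\<in>root_monomials r i j. w p * class_act r (\<lambda>_. 1) N (pbw r p)) = 0"
    and p: "p \<in> root_monomials r i j"
  shows "w p = 0"
  using p
proof (induction "length (expand r p)" arbitrary: p rule: less_induct)
  case less
  define P where "P = root_monomials r i j"
  note P_iff = root_monomials_eq[OF assms(1-3), folded P_def]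
  have chain: "chain i (expand r q) j" if "q \<in> P" for q using that by (simp add: P_iff)
  define S where "S = fst ` set (expand r p)"
  define N :: exvec where "N = (\<lambda>n. of_bool (n \<in> S))"
  \<comment> \<open>A surviving \<open>q\<close> has its starts in \<open>S\<close>. If its chain is
    shorter, the coefficient vanishes by induction; otherwise its starts fill \<open>S\<close>, and
    \<open>q = p\<close>.\<close>
  have "w q * class_act r (\<lambda>_. 1) N (pbw r q) = (if q = p then w p else 0)" if "q \<in> P" for q
  proof -
    have val: "class_act r (\<lambda>_. 1) N (pbw r q) = of_bool (fst ` set (expand r q) \<subseteq> S)"
      using chain[OF that] by (auto simp: class_act_pbw N_def prod_list_of_bool)
    show ?thesis
    proof (cases "fst ` set (expand r q) \<subseteq> S")
      case True
      have len: "length (expand r q) = card (fst ` set (expand r q))" "length (expand r p) = card S"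
        using chain_length[OF chain[OF that]] chain_length[OF chain] less.prems by (auto simp: S_def P_def)
      show ?thesis
      proof (cases "length (expand r q) < length (expand r p)")
        case True
        then show ?thesis using less.hyps[OF True] that by (auto simp: P_def)
      next
        case False
        have "fst ` set (expand r q) = S"
          using True False len by (intro card_seteq) (auto simp: S_def)
        then have "expand r q = expand r p"
          using chain_determined_by_starts[OF chain[OF that] chain] less.prems by (simp add: S_def P_def)
        then have "q = p"
          using that less.prems by (auto simp: P_def root_monomials_def intro: expand_inj)
        moreover have "class_act r (\<lambda>_. 1) N (pbw r q) = 1" using val True by simp
        ultimately show ?thesis by simp
      qed
    next
      case False
      then show ?thesis by (auto simp: val S_def)
    qed
  qed
  then have "(\<Sum>q\<in>P. w q * class_act r (\<lambda>_. 1) N (pbw r q)) = (\<Sum>q\<in>P. if q = p then w p else 0)"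
    by (rule sum.cong[OF refl])
  also have "\<dots> = w p"
    using less.prems finite_root_monomials[OF assms(1-3)] by (simp add: P_def)
  finally show ?case using eq[of N] by (simp add: P_def)
qed

text \<open>The existence half of the description that defines \<open>omega\<close>, stated for any
  tensor so that it can be checked summand by summand.\<close>

definition expressible :: "nat \<Rightarrow> nat \<Rightarrow> nat \<Rightarrow> (falg set \<Rightarrow>\<^sub>0 ratfun) \<Rightarrow> bool" where
  "expressible r i j t \<longleftrightarrow> (\<exists>w. (\<forall>p. p \<notin> root_monomials r i j \<longrightarrow> w p = 0) \<and>
     tensor_eq (U_nminus r) t (\<Sum>p\<in>root_monomials r i j. pure_tensor (w p) (pbw r p)))"

lemma expressible_cong: "expressible r i j t \<Longrightarrow> tensor_eq (U_nminus r) t' t \<Longrightarrow> expressible r i j t'"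
  unfolding expressible_def using tensor_eq_trans by blast

lemma expressible_zero: "expressible r i j 0"
  unfolding expressible_def by (rule exI[of _ "\<lambda>_. 0"]) (simp add: tensor_eq_refl)

lemma expressible_add:
  assumes "expressible r i j t" "expressible r i j t'"
  shows "expressible r i j (t + t')"
proof -
  obtain w w' where w: "\<forall>p. p \<notin> root_monomials r i j \<longrightarrow> w p = 0"
    "tensor_eq (U_nminus r) t (\<Sum>p\<in>root_monomials r i j. pure_tensor (w p) (pbw r p))"
    and w': "\<forall>p. p \<notin> root_monomials r i j \<longrightarrow> w' p = 0"
    "tensor_eq (U_nminus r) t' (\<Sum>p\<in>root_monomials r i j. pure_tensor (w' p) (pbw r p))"
    using assms unfolding expressible_def by blast
  show ?thesis
    unfolding expressible_def
    using w(1) w'(1) tensor_eq_add[OF w(2) w'(2)]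
    by (intro exI[of _ "\<lambda>p. w p + w' p"]) (simp add: single_add sum.distrib)
qed

lemma expressible_sum: "(\<And>a. a \<in> A \<Longrightarrow> expressible r i j (f a)) \<Longrightarrow> expressible r i j (\<Sum>a\<in>A. f a)"
  by (induction A rule: infinite_finite_induct) (simp_all add: expressible_zero expressible_add)

text \<open>Sums and scalar multiples in \<open>chain_span\<close> match the tensor relations, and
  \<open>cong\<close> leaves the coset unchanged. The coefficient \<open>g\<close> is arbitrary
  because the scalar case absorbs a constant into it.\<close>

lemma chain_span_expressible:
  assumes ij: "1 \<le> i" "i < j" "j \<le> r" and "x \<in> chain_span r i j"
  shows "expressible r i j (pure_tensor g (qmap r x))"
  using assms(4)
proof (induction arbitrary: g)
  case (base L)
  have roots: "set L \<subseteq> set (pos_roots r)"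
    using chain_pos_roots[OF base] ij by simp
  define p where "p = count_list L"
  have p: "p \<in> exponents r" "expand r p = L"
    unfolding p_def using expand_count_list[OF chain_sorted[OF base] roots] by blast+
  then have mem: "p \<in> root_monomials r i j"
    using base by (simp add: root_monomials_eq[OF ij])
  have "(\<Sum>q\<in>root_monomials r i j. pure_tensor (if q = p then g else 0) (pbw r q))
      = (\<Sum>q\<in>root_monomials r i j. if q = p then pure_tensor g (pbw r p) else 0)"
    by (intro sum.cong) auto
  also have "\<dots> = pure_tensor g (qmap r (free_prod L))"
    using mem finite_root_monomials[OF ij] p(2) by (simp add: pbw_eq)
  finally show ?case
    unfolding expressible_def using mem
    by (intro exI[of _ "\<lambda>q. if q = p then g else 0"]) (auto simp: tensor_eq_refl)
next
  case (add x y)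
  have "x \<in> carrier (U_free r)" "y \<in> carrier (U_free r)"
    using add.hyps ij by (auto intro: chain_span_carrier)
  then have "tensor_eq (U_nminus r) (pure_tensor g (qmap r (x + y)))
      (pure_tensor g (qmap r x) + pure_tensor g (qmap r y))"
    using tensor_null.null_additive[where g = g, of "qmap r x" "U_nminus r" "qmap r y"]
    by (simp add: tensor_eq_def qmap_add U_nminus_carrier algebra_simps)
  with expressible_add[OF add.IH] show ?case by (rule expressible_cong)
next
  case (scale x c)
  have "x \<in> carrier (U_free r)"
    using scale.hyps ij by (auto intro: chain_span_carrier)
  then have "tensor_eq (U_nminus r) (pure_tensor g (qmap r (Poly_Mapping.single [] c * x)))
      (pure_tensor (g * rconst c) (qmap r x))"
    using tensor_null.null_scalar[where g = g, of "qmap r x" "U_nminus r" c]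
    by (simp add: tensor_eq_def qmap_smult U_nminus_carrier)
  with scale.IH show ?case by (rule expressible_cong)
next
  case (cong x y)
  have "y \<in> chain_span r i j" using cong.hyps by (rule chain_span.cong)
  then have "x \<in> carrier (U_free r)" "y \<in> carrier (U_free r)"
    using cong.hyps ij by (auto intro: chain_span_carrier)
  then have "qmap r y = qmap r x"
    using cong.hyps by (simp add: qmap_eq_iff)
  with cong.IH show ?case by simp
qed

lemma fJ_eq: "fJ n J = Poly_Mapping.single (map J (rev [1..<Suc n])) 1"
proof -
  have "prod_list (map (\<lambda>u. fgen (J u)) us) = Poly_Mapping.single (map J us) 1" for us
    by (induction us) (simp_all add: single_Nil_one single_Cons)
  then show ?thesis by (simp add: fJ_def del: upt_Suc)
qed

lemma size_root_coeff: "1 \<le> i \<Longrightarrow> j \<le> r \<Longrightarrow> size_k r (root_coeff (i, j)) = j - i"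
proof -
  assume "1 \<le> i" "j \<le> r"
  then have "size_k r (root_coeff (i, j)) = (\<Sum>m\<in>{i..<j}. 1)"
    unfolding size_k_def by (intro sum.mono_neutral_cong_right) auto
  then show ?thesis by simp
qed

text \<open>All coefficients of the root are 0 or 1, so a coloring arranges the letters
  \<open>i, ..., j - 1\<close>; injectivity follows by counting.\<close>

lemma colorings_image:
  assumes "1 \<le> i" "j \<le> r" "J \<in> colorings r (root_coeff (i, j))"
  shows "J ` {1..j - i} = {i..<j}" "inj_on J {1..j - i}"
proof -
  have J: "J \<in> {1..j - i} \<rightarrow>\<^sub>E {1..<r}"
    and card: "\<And>m. m \<in> {1..<r} \<Longrightarrow> card {u \<in> {1..j - i}. J u = m} = root_coeff (i, j) m"
    using assms(3) by (simp_all add: colorings_def size_root_coeff[OF assms(1,2)])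
  show image: "J ` {1..j - i} = {i..<j}"
  proof (intro equalityI subsetI)
    fix m assume m: "m \<in> J ` {1..j - i}"
    then have "m \<in> {1..<r}" "{u \<in> {1..j - i}. J u = m} \<noteq> {}" using J by auto
    then have "card {u \<in> {1..j - i}. J u = m} \<noteq> 0"
      by (simp only: card_eq_0_iff) simp
    then have "root_coeff (i, j) m \<noteq> 0" by (simp only: card[OF \<open>m \<in> {1..<r}\<close>] not_False_eq_True)
    then show "m \<in> {i..<j}" by (simp split: if_splits)
  next
    fix m assume "m \<in> {i..<j}"
    then have "card {u \<in> {1..j - i}. J u = m} \<noteq> 0"
      using card[of m] assms(1,2) by simp
    then have "{u \<in> {1..j - i}. J u = m} \<noteq> {}" by (metis card.empty)
    then show "m \<in> J ` {1..j - i}" by blast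
  qed
  then show "inj_on J {1..j - i}"
    by (intro eq_card_imp_inj_on) simp_all
qed

lemma Omega_g_eq:
  "Omega_g r k = (\<Sum>J\<in>colorings r k.
     pure_tensor (Sym r k (chain_prod (size_k r k) J)) (qmap r (fJ (size_k r k) J)))"
  by (simp add: Omega_g_def Omega_def id_tensor_sum id_tensor_single)

lemma Omega_g_expressible:
  assumes "1 \<le> i" "i < j" "j \<le> r"
  shows "expressible r i j (Omega_g r (root_coeff (i, j)))"
  unfolding Omega_g_eq
proof (intro expressible_sum chain_span_expressible assms)
  fix J assume "J \<in> colorings r (root_coeff (i, j))"
  note J = colorings_image[OF assms(1,3) this]
  have "set (map J (rev [1..<Suc (j - i)])) = J ` {1..j - i}"
    by (simp add: atLeastLessThanSuc_atLeastAtMost del: upt_Suc)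
  moreover have "distinct (map J (rev [1..<Suc (j - i)]))"
    using J(2) by (simp add: distinct_map atLeastLessThanSuc_atLeastAtMost del: upt_Suc)
  ultimately show "fJ (size_k r (root_coeff (i, j))) J \<in> chain_span r i j"
    using assms J(1) by (simp only: fJ_eq size_root_coeff) (intro word_in_chain_span; simp)
qed

text \<open>Justifies the definite description in \<open>omega\<close>: the spanning argument gives
  existence, and the difference of two solutions is killed by all functionals in
  \<open>pbw_independent\<close>.\<close>

lemma omega_spec:
  assumes "1 \<le> i" "i < j" "j \<le> r"
  shows "tensor_eq (U_nminus r) (Omega_g r (root_coeff (i, j)))
    (\<Sum>p\<in>root_monomials r i j. pure_tensor (omega r (root_coeff (i, j)) p) (pbw r p))"
proof -
  define P where "P = root_monomials r i j"
  define good where "good w \<longleftrightarrow> (\<forall>p. p \<notin> P \<longrightarrow> w p = 0) \<and>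
    tensor_eq (U_nminus r) (Omega_g r (root_coeff (i, j))) (\<Sum>p\<in>P. pure_tensor (w p) (pbw r p))" for w
  have omega: "omega r (root_coeff (i, j)) = (THE w. good w)"
    by (simp add: omega_def good_def[abs_def] P_def root_monomials_def)
  obtain w where w: "good w"
    using Omega_g_expressible[OF assms] unfolding expressible_def good_def P_def by blast
  have "w' = w" if w': "good w'" for w'
  proof
    fix p
    have "(\<Sum>q\<in>P. (w' q - w q) * class_act r (\<lambda>_. 1) N (pbw r q)) = 0" for N
    proof -
      have "linear_ext (class_act r (\<lambda>_. 1) N) (Omega_g r (root_coeff (i, j)))
          = (\<Sum>q\<in>P. v q * class_act r (\<lambda>_. 1) N (pbw r q))" if "good v" for v
        using that class_act_tensor_eq[of r "Omega_g r (root_coeff (i, j))"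
          "\<Sum>p\<in>P. pure_tensor (v p) (pbw r p)" "\<lambda>_. 1" N]
        by (simp add: good_def linear_ext_sum)
      from this[OF w] this[OF w'] show ?thesis
        by (simp add: left_diff_distrib sum_subtractf)
    qed
    then have "p \<in> P \<Longrightarrow> w' p - w p = 0"
      using pbw_independent[OF assms, of "\<lambda>q. w' q - w q" p] by (simp add: P_def)
    then show "w' p = w p" using w w' by (cases "p \<in> P") (auto simp: good_def)
  qed
  with w have "good (THE w. good w)" by (rule theI)
  then show ?thesis by (simp add: good_def omega P_def)
qed

section \<open>Evaluation at a single variable\<close>

lemma word_op_indicator:
  "word_op w (\<lambda>_. 1) (\<lambda>n. of_bool (n = a)) = of_bool (rev w = [a..<a + length w])"
proof (induction w arbitrary: a rule: rev_induct)
  case (snoc m w)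
  have "shift a (Suc a) (\<lambda>n. of_bool (n = a)) = (\<lambda>n. of_bool (n = Suc a))"
    by (simp add: shift_def fun_eq_iff)
  then have "word_op (w @ [m]) (\<lambda>_. 1) (\<lambda>n. of_bool (n = a))
      = of_bool (m = a) * word_op w (\<lambda>_. 1) (\<lambda>n. of_bool (n = Suc a))"
    by (auto simp: word_op_append word_op_Cons lowering_def)
  moreover have "[a..<a + length (w @ [m])] = a # [Suc a..<Suc a + length w]"
    by (subst upt_conv_Cons) simp_all
  ultimately show ?case by (simp add: snoc.IH)
qed simp

text \<open>For \<open>n = j - i\<close>, the coloring whose word is \<open>f_(j-1) ... f_i\<close>.
  The restriction to \<open>{1..n}\<close> places it in the extensional function space used by
  \<open>colorings\<close>.\<close>

definition ascending :: "nat \<Rightarrow> nat \<Rightarrow> nat \<Rightarrow> nat" where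
  "ascending i n = (\<lambda>u\<in>{1..n}. i + u - 1)"

lemma ascending_in_colorings:
  assumes "1 \<le> i" "j \<le> r"
  shows "ascending i (j - i) \<in> colorings r (root_coeff (i, j))"
proof -
  have "{u \<in> {1..j - i}. ascending i (j - i) u = m} = (if i \<le> m \<and> m < j then {m - i + 1} else {})" for m
    by (auto simp: ascending_def)
  then show ?thesis
    using assms by (auto simp: colorings_def size_root_coeff ascending_def)
qed

lemma coloring_ascending_iff:
  assumes "J \<in> extensional {1..n}"
  shows "map J [1..<Suc n] = [i..<i + n] \<longleftrightarrow> J = ascending i n"
proof
  assume eq: "map J [1..<Suc n] = [i..<i + n]"
  show "J = ascending i n"
  proof (rule extensionalityI[OF assms])
    fix u assume "u \<in> {1..n}"
    then show "J u = ascending i n u"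
      using arg_cong[OF eq, of "\<lambda>xs. xs ! (u - 1)"] by (auto simp: ascending_def simp del: upt_Suc)
  qed (simp add: ascending_def)
next
  assume "J = ascending i n"
  then show "map J [1..<Suc n] = [i..<i + n]"
    by (intro nth_equalityI) (auto simp: ascending_def simp del: upt_Suc)
qed

lemma Sym_ascending:
  assumes "1 \<le> i" "i < j" "j \<le> r"
  shows "Sym r (root_coeff (i, j)) (chain_prod (j - i) (ascending i (j - i)))
    = 1 / (tvar i 1 * (\<Prod>m\<in>{i+1..j-1}. tvar m 1 - tvar (m - 1) 1))"
proof -
  define J where "J = ascending i (j - i)"
  \<comment> \<open>Each upper index has at most one variable, so the symmetrization has a single
    term.\<close>
  have "{\<pi>. \<pi> permutes {1..root_coeff (i, j) m}} = {id}" for m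
    by auto
  then have "G_group r (root_coeff (i, j)) = {\<lambda>m\<in>{1..<r}. id}"
    unfolding G_group_def by (auto simp: PiE_iff extensional_def fun_eq_iff restrict_def simp del: root_coeff.simps)
  then have "Sym r (root_coeff (i, j)) (chain_prod (j - i) J)
      = chain_prod (j - i) J (\<lambda>a b. tvar a ((\<lambda>m\<in>{1..<r}. id) a b))"
    by (simp add: Sym_def)
  \<comment> \<open>The value 0 at \<open>u = 1\<close> is the convention \<open>t_0 = 0\<close>; it
    produces the factor \<open>1 / tvar i 1\<close>.\<close>
  also have "\<dots> = (\<Prod>u\<in>{1..j - i}. 1 / (tvar (i + u - 1) 1 - (if u = 1 then 0 else tvar (i + u - 2) 1)))"
  proof -
    have J: "J u = i + u - 1" if "1 \<le> u" "u \<le> j - i" for u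
      using that by (simp add: J_def ascending_def)
    have cpos: "cpos J u = 1" if "1 \<le> u" "u \<le> j - i" for u
    proof -
      have "{v \<in> {1..u}. J v = J u} = {u}" using that by (auto simp: J)
      then show ?thesis by (simp add: cpos_def)
    qed
    show ?thesis
      unfolding chain_prod_def
    proof (rule prod.cong[OF refl])
      fix u assume u: "u \<in> {1..j - i}"
      have "tseq J (\<lambda>a b. tvar a ((\<lambda>m\<in>{1..<r}. id) a b)) v = (if v = 0 then 0 else tvar (i + v - 1) 1)"
        if "v \<le> j - i" for v
        using that assms J[of v] cpos[of v] by (auto simp: tseq_def)
      then show "1 / (tseq J (\<lambda>a b. tvar a ((\<lambda>m\<in>{1..<r}. id) a b)) u
          - tseq J (\<lambda>a b. tvar a ((\<lambda>m\<in>{1..<r}. id) a b)) (u - 1))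
        = 1 / (tvar (i + u - 1) 1 - (if u = 1 then 0 else tvar (i + u - 2) 1))"
        using u by (auto simp: numeral_2_eq_2)
    qed
  qed
  also have "\<dots> = (1 / tvar i 1) * (\<Prod>u\<in>{2..j - i}. 1 / (tvar (i + u - 1) 1 - tvar (i + u - 2) 1))"
  proof -
    have "{1..j - i} = insert 1 {2..j - i}" using assms by auto
    then show ?thesis by (simp add: prod.insert)
  qed
  also have "(\<Prod>u\<in>{2..j - i}. 1 / (tvar (i + u - 1) 1 - tvar (i + u - 2) 1))
      = (\<Prod>m\<in>{i+1..j-1}. 1 / (tvar m 1 - tvar (m - 1) 1))"
    using assms
    by (intro prod.reindex_bij_witness[of _ "\<lambda>m. m + 1 - i" "\<lambda>u. i + u - 1"]) (auto simp: numeral_2_eq_2)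
  finally show ?thesis
    by (simp add: J_def prod_dividef del: root_coeff.simps)
qed

text \<open>Both sides of \<open>omega_spec\<close> are evaluated at the indicator of
  \<open>i\<close>: only the ascending word survives on the left, and only the one-step chain on the
  right.\<close>

lemma omega_root:
  assumes ij: "1 \<le> i" "i < j" "j \<le> r"
    and p: "p \<in> exponents r" "expand r p = [(i, j)]"
  shows "omega r (root_coeff (i, j)) p
    = Sym r (root_coeff (i, j)) (chain_prod (j - i) (ascending i (j - i)))"
proof -
  define k where "k = root_coeff (i, j)"
  define N :: exvec where "N = (\<lambda>n. of_bool (n = i))"
  define h where "h = class_act r (\<lambda>_. 1) N"
  have size: "size_k r k = j - i" unfolding k_def using ij by (intro size_root_coeff) auto
  have mem: "p \<in> root_monomials r i j" using p ij(2) by (simp add: root_monomials_eq[OF ij])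
  have "linear_ext h (Omega_g r k)
      = (\<Sum>J\<in>colorings r k. Sym r k (chain_prod (j - i) J) * h (qmap r (fJ (j - i) J)))"
    by (simp add: Omega_g_eq linear_ext_sum size)
  also have "\<dots> = (\<Sum>J\<in>colorings r k. if J = ascending i (j - i) then Sym r k (chain_prod (j - i) J) else 0)"
  proof (rule sum.cong[OF refl])
    fix J assume J: "J \<in> colorings r k"
    then have ext: "J \<in> extensional {1..j - i}" and range: "J ` {1..j - i} \<subseteq> {1..<r}"
      by (auto simp: colorings_def size PiE_def)
    have "h (qmap r (fJ (j - i) J)) = of_bool (J = ascending i (j - i))"
    proof -
      have "set (map J (rev [1..<Suc (j - i)])) \<subseteq> {1..<r}"
        using range by (simp add: atLeastLessThanSuc_atLeastAtMost del: upt_Suc)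
      then have "h (qmap r (fJ (j - i) J))
          = rconst (word_op (map J (rev [1..<Suc (j - i)])) (\<lambda>_. 1) (\<lambda>n. of_bool (n = i)))"
        unfolding h_def fJ_eq N_def
        by (subst class_act_qmap) (simp_all add: U_free_carrier_intros act_single del: upt_Suc)
      also have "\<dots> = of_bool (J = ascending i (j - i))"
        by (simp add: word_op_indicator rev_map coloring_ascending_iff[OF ext, symmetric] del: upt_Suc)
      finally show ?thesis .
    qed
    then show "Sym r k (chain_prod (j - i) J) * h (qmap r (fJ (j - i) J))
        = (if J = ascending i (j - i) then Sym r k (chain_prod (j - i) J) else 0)"
      by simp
  qed
  also have "\<dots> = Sym r k (chain_prod (j - i) (ascending i (j - i)))"
  proof -
    have "finite (colorings r k)"
      unfolding colorings_def by (rule finite_subset[of _ "{1..size_k r k} \<rightarrow>\<^sub>E {1..<r}"]) (auto intro: finite_PiE)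
    then show ?thesis
      using ascending_in_colorings[OF ij(1,3)] by (simp add: k_def)
  qed
  finally have lhs: "linear_ext h (Omega_g r k) = Sym r k (chain_prod (j - i) (ascending i (j - i)))" .
  have "linear_ext h (Omega_g r k) = (\<Sum>q\<in>root_monomials r i j. omega r k q * h (pbw r q))"
    using class_act_tensor_eq[OF omega_spec[OF ij], of "\<lambda>_. 1" N]
    by (simp add: h_def k_def linear_ext_sum del: root_coeff.simps)
  also have "\<dots> = (\<Sum>q\<in>root_monomials r i j. if q = p then omega r k p else 0)"
  proof (rule sum.cong[OF refl])
    fix q assume "q \<in> root_monomials r i j"
    then have q: "q \<in> exponents r" "chain i (expand r q) j" by (simp_all add: root_monomials_eq[OF ij])
    have "h (pbw r q) = of_bool (expand r q = [(i, j)])"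
      unfolding h_def class_act_pbw[OF q(2)] N_def prod_list_starts_indicator[OF q(2) ij(2)] by simp
    moreover have "expand r q = [(i, j)] \<longleftrightarrow> q = p"
      using p q(1) expand_inj by metis
    ultimately show "omega r k q * h (pbw r q) = (if q = p then omega r k p else 0)" by simp
  qed
  also have "\<dots> = omega r k p"
    using mem finite_root_monomials[OF ij] by simp
  finally show ?thesis using lhs by (simp add: k_def)
qed

text \<open>Serves the definite description in \<open>eta\<close>. Equal cosets have equal content,
  which yields a chain; at the indicator of \<open>i\<close> the root vector acts with value 1, and
  only the one-step chain attains it.\<close>

lemma root_exponent_unique:
  assumes ij: "1 \<le> i" "i < j" "j \<le> r"
    and p: "p \<in> exponents r" "pbw r p = root_vec r (i, j)"
  shows "expand r p = [(i, j)]"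
proof -
  have root: "free_prod [(i, j)] \<in> carrier (U_free r)"
    using ij by (intro free_prod_carrier) (simp add: set_pos_roots)
  have eq: "qmap r (free_prod (expand r p)) = qmap r (free_prod [(i, j)])"
    using p(2) by (simp add: pbw_eq root_vec_eq[OF ij] del: root_vec.simps)
  have "free_prod [(i, j)] \<in> U_deg r (root_coeff (i, j))"
    using root free_root_content[OF ij(2)] by (simp add: U_deg_def del: root_coeff.simps)
  then have "has_content r (root_coeff (i, j)) (pbw r p)"
    unfolding has_content_def pbw_eq eq by blast
  then have chain: "chain i (expand r p) j"
    using has_content_pbw_iff[OF ij] by blast
  define N :: exvec where "N = (\<lambda>n. of_bool (n = i))"
  have "act (free_prod (expand r p)) (\<lambda>_. 1) N = act (free_prod [(i, j)]) (\<lambda>_. 1) N"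
    by (rule act_qmap_eq[OF free_prod_carrier[OF set_expand] root eq])
  then have "(\<Prod>\<beta>\<leftarrow>expand r p. N (fst \<beta>)) = 1"
    using ij(2) by (simp add: act_chain[OF chain] act_free_root lowering_def N_def)
  then show ?thesis
    unfolding N_def prod_list_starts_indicator[OF chain ij(2)] by simp
qed

theorem theorem6p5:
  fixes r i j :: nat
  assumes "1 \<le> i" and "i < j" and "j \<le> r"
  shows "eta r (i, j) =
    1 / (tvar i 1 * (\<Prod>m\<in>{i+1..j-1}. tvar m 1 - tvar (m - 1) 1))"
proof -
  \<comment> \<open>The exponent function that is 1 at \<open>(i, j)\<close> and 0
    elsewhere.\<close>
  define p where "p = count_list [(i, j)]"
  have p: "p \<in> exponents r" "expand r p = [(i, j)]"
    unfolding p_def using assms expand_count_list[of "[(i, j)]" r] by (auto simp: set_pos_roots)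
  have "(THE p. p \<in> exponents r \<and> pbw r p = root_vec r (i, j)) = p"
  proof (rule the_equality)
    show "p \<in> exponents r \<and> pbw r p = root_vec r (i, j)"
      using p assms by (simp add: pbw_eq root_vec_eq del: root_vec.simps)
    show "q = p" if "q \<in> exponents r \<and> pbw r q = root_vec r (i, j)" for q
      using that root_exponent_unique[OF assms, of q] p expand_inj by metis
  qed
  then show ?thesis
    unfolding eta_def using omega_root[OF assms p] Sym_ascending[OF assms] by simp
qed

end
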